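(* Let $N=(N_t)_{t\ge0}$ be a Poisson process with intensity $\theta$ and let $X_1,X_2,\ldots$ be a sequence of independent random variables. Then the Laplace transform of the integrated process $$\Lambda_t=\int_0^t\sum_{i=1}^{N_u}X_i\,du$$ is given by $$\phi_{\Lambda_t}(x)=e^{-\theta t}\left(1+\sum_{n=1}^{\infty}\theta^n\int_{t_1=0}^t\phi_{X_1}(x(t-t_1))\cdots\int_{t_n=t_{n-1}}^t\phi_{X_n}(x(t-t_n))\,d\vec{t}_n\right).$$
   Context: For a random variable $Z$, $\phi_Z(x):=\mathbb{E}[e^{-xZ}]$ denotes its Laplace transform. The process $\lambda_t=\sum_{i=1}^{N_t}X_i$ is called a generalized compound Poisson process: jumps arrive according to $N$, and the size of the $i$-th jump is $X_i$, the $X_i$ being mutually independent. Here $\vec{t}_n=(t_1,\ldots,t_n)$, and the $n$-th term is an iterated integral with integrand $\prod_{i=1}^n\phi_{X_i}(x(t-t_i))$ over the domain $0\le t_1\le t_2\le\cdots\le t_n\le t$ (with $t_0:=0$).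
   Formalization: The Poisson process N is additionally assumed to be independent of the sequence X_1, X_2, …, as is usual for compound Poisson processes; without this the formula fails, e.g. if X_1 depends on the first jump time of N. *)

theory Defs
  imports "HOL-Probability.Probability"
begin

text \<open>
  A process is indexed by all of the type \<^typ>\<open>real\<close>, but only its values at times
  \<open>\<ge> 0\<close> matter. Subtraction of natural numbers truncates; since almost every path is
  nondecreasing, it agrees with the true increment almost surely.
\<close>

definition (in prob_space) poisson_process :: "real \<Rightarrow> (real \<Rightarrow> 'a \<Rightarrow> nat) \<Rightarrow> bool" where
  "poisson_process \<theta> N \<longleftrightarrow>
     \<theta> > 0 \<and>
     (\<forall>t\<ge>0. random_variable (count_space UNIV) (N t)) \<and>
     (AE \<omega> in M. N 0 \<omega> = 0) \<and>
     (AE \<omega> in M. mono_on {0..} (\<lambda>t. N t \<omega>) \<and>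
                 (\<forall>t\<ge>0. continuous (at_right t) (\<lambda>u. N u \<omega>))) \<and>
     (\<forall>n. \<forall>\<tau> :: nat \<Rightarrow> real. 0 \<le> \<tau> 0 \<and> (\<forall>i<n. \<tau> i < \<tau> (Suc i)) \<longrightarrow>
        indep_vars (\<lambda>_. count_space UNIV) (\<lambda>i \<omega>. N (\<tau> (Suc i)) \<omega> - N (\<tau> i) \<omega>) {..<n}) \<and>
     (\<forall>s t. 0 \<le> s \<and> s < t \<longrightarrow>
        distr M (count_space UNIV) (\<lambda>\<omega>. N t \<omega> - N s \<omega>) = measure_pmf (poisson_pmf (\<theta> * (t - s))))"

text \<open>The \<open>\<sigma>\<close>-algebra on \<^term>\<open>space M\<close> generated by the family \<open>(Y\<^sub>i)\<close>, \<open>i \<in> I\<close>, of \<open>S\<close>-valued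
  random variables. The library's \<open>indep_var\<close> cannot be applied to two processes whose index and
  value types differ, so their independence is stated as independence of these \<open>\<sigma>\<close>-algebras.\<close>

definition generated_events ::
  "'a measure \<Rightarrow> 'b measure \<Rightarrow> 'i set \<Rightarrow> ('i \<Rightarrow> 'a \<Rightarrow> 'b) \<Rightarrow> 'a set set" where
  "generated_events M S I Y =
     sigma_sets (space M) (\<Union>i\<in>I. {Y i -` A \<inter> space M | A. A \<in> sets S})"

text \<open>The expectation of the nonnegative variable \<open>exp (-x Z)\<close>, as an element of \<open>[0,\<infinity>]\<close>; it may
  be infinite if \<open>x Z\<close> is not bounded below.\<close>

definition laplace_transform :: "'a measure \<Rightarrow> ('a \<Rightarrow> real) \<Rightarrow> real \<Rightarrow> ennreal" where
  "laplace_transform M Z x = (\<integral>\<^sup>+\<omega>. ennreal (exp (- (x * Z \<omega>))) \<partial>M)"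

definition compound_process ::
  "(real \<Rightarrow> 'a \<Rightarrow> nat) \<Rightarrow> (nat \<Rightarrow> 'a \<Rightarrow> real) \<Rightarrow> real \<Rightarrow> 'a \<Rightarrow> real" where
  "compound_process N X t \<omega> = (\<Sum>i = 1..N t \<omega>. X i \<omega>)"

definition integrated_process ::
  "(real \<Rightarrow> 'a \<Rightarrow> nat) \<Rightarrow> (nat \<Rightarrow> 'a \<Rightarrow> real) \<Rightarrow> real \<Rightarrow> 'a \<Rightarrow> real" where
  "integrated_process N X t \<omega> = (LINT u:{0..t}|lborel. compound_process N X u \<omega>)"

text \<open>\<open>iterated_integral t [f\<^sub>1, \<dots>, f\<^sub>n] t\<^sub>0\<close> is the integral of \<open>f\<^sub>1 t\<^sub>1\<close> times the integral of
  \<open>f\<^sub>2 t\<^sub>2\<close> times \<open>\<dots>\<close> times the integral of \<open>f\<^sub>n t\<^sub>n\<close>, where \<open>t\<^sub>i\<close> ranges from \<open>t\<^bsub>i-1\<^esub>\<close> to \<open>t\<close>.\<close>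

primrec iterated_integral :: "real \<Rightarrow> (real \<Rightarrow> ennreal) list \<Rightarrow> real \<Rightarrow> ennreal" where
  "iterated_integral t [] s = 1"
| "iterated_integral t (f # fs) s = (\<integral>\<^sup>+u\<in>{s..t}. (f u * iterated_integral t fs u) \<partial>lborel)"

end

theory Submission
  imports Defs
begin

text \<open>
  Freeze the jump sizes and let \<open>S k\<close> be \<open>x\<close> times the sum of the first \<open>k\<close> of them. Write \<open>F\<^sub>n(S, s)\<close> for
  the expectation of \<open>exp (- \<integral>\<^sub>s\<^sup>t S (N\<^sub>u - N\<^sub>s) du)\<close> on the event \<open>N\<^sub>t - N\<^sub>s = n\<close>. Splitting by the number
  of jumps in \<open>(s, s + h]\<close> (none, one, at least two) and using independent increments gives, uniformly in \<open>s\<close>,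
  \<open>F\<^bsub>n+1\<^esub>(S, s) = e\<^bsup>-(\<theta> + S 0) h\<^esup> (F\<^bsub>n+1\<^esub>(S, s + h) + \<theta> h F\<^sub>n(S \<circ> Suc, s + h)) + O(h\<^sup>2)\<close>. Up to the factor
  \<open>\<theta>\<^sup>n e\<^bsup>-(\<theta> + S 0)(t - s)\<^esup>\<close> this is the backward equation of the iterated integral of the functions
  \<open>exp (- (S i - S (i - 1)) (t - u))\<close>, so no arrival times or their joint law are needed. Independence of
  \<open>N\<close> and \<open>X\<close> allows integrating over the jump sizes afterwards, which replaces each exponential by a
  Laplace transform.
\<close>

subsection \<open>Riemann sums and quadratic error estimates\<close>

text \<open>Under this bound both \<open>f + g\<close> and \<open>g\<close> are nondecreasing, so
  \<open>f\<close> is a difference of monotone functions.\<close>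

lemma integrable_on_dominated_oscillation:
  fixes f g :: "real \<Rightarrow> real"
  assumes "\<And>u v. a \<le> u \<Longrightarrow> u \<le> v \<Longrightarrow> v \<le> b \<Longrightarrow> \<bar>f u - f v\<bar> \<le> g v - g u"
  shows "f integrable_on {a..b}" "f \<in> borel_measurable (restrict_space borel {a..b})"
proof -
  have 1: "mono_on {a..b} (\<lambda>u. f u + g u)"
    using assms by (intro mono_onI) (smt (verit) atLeastAtMost_iff)
  have 2: "mono_on {a..b} g"
    using assms by (intro mono_onI) (smt (verit) atLeastAtMost_iff)
  have eq: "f = (\<lambda>u. (f u + g u) - g u)" by auto
  show "f integrable_on {a..b}"
    by (subst eq, intro integrable_diff integrable_on_mono_on 1 2)
  show "f \<in> borel_measurable (restrict_space borel {a..b})"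
    by (subst eq, intro borel_measurable_diff borel_measurable_mono_on_fnc 1 2)
qed

text \<open>On each cell \<open>f\<close> differs from its right endpoint value by at most the
  increment of \<open>g\<close>. Multiplied by the mesh, these increments telescope; the induction
  adds one cell at a time.\<close>

lemma riemann_sum_error:
  fixes f g :: "real \<Rightarrow> real"
  assumes "a \<le> b" "m > 0"
    and osc: "\<And>u v. a \<le> u \<Longrightarrow> u \<le> v \<Longrightarrow> v \<le> b \<Longrightarrow> \<bar>f u - f v\<bar> \<le> g v - g u"
  shows "\<bar>(b - a) / real m * (\<Sum>k = 1..m. f (a + real k * ((b - a) / real m))) - integral {a..b} f\<bar>
           \<le> (b - a) / real m * (g b - g a)"
proof -
  define h where "h = (b - a) / real m"
  define p where "p k = a + real k * h" for k
  have h: "h \<ge> 0" and mh: "real m * h = b - a"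
    using assms by (auto simp: h_def)
  have p_le: "p k \<le> b" if "k \<le> m" for k
    using mult_right_mono[of "real k" "real m" h] that h mh by (auto simp: p_def)
  have p_ge: "a \<le> p k" for k using h by (simp add: p_def)
  have p_Suc: "p (Suc k) = p k + h" for k by (simp add: p_def algebra_simps)
  have "\<bar>h * (\<Sum>k = 1..j. f (p k)) - integral {a..p j} f\<bar> \<le> h * (g (p j) - g a)" if "j \<le> m" for j
    using that
  proof (induction j)
    case 0
    then show ?case by (simp add: p_def)
  next
    case (Suc j)
    have le: "a \<le> p j" "p j \<le> p (Suc j)" "p (Suc j) \<le> b"
      using p_ge p_le[OF Suc.prems] h by (auto simp: p_Suc)
    have int: "f integrable_on {u..v}" if "a \<le> u" "v \<le> b" for u v
      by (rule integrable_on_dominated_oscillation[where g = g]) (use that in \<open>intro osc; linarith\<close>)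
    have split: "integral {a..p (Suc j)} f = integral {a..p j} f + integral {p j..p (Suc j)} f"
      using le by (intro Henstock_Kurzweil_Integration.integral_combine[symmetric] int) auto
    have "norm (integral {p j..p (Suc j)} (\<lambda>u. f u - f (p (Suc j))))
            \<le> (g (p (Suc j)) - g (p j)) * measure lborel {p j..p (Suc j)}"
    proof (rule has_integral_bound_real[OF _ finite.emptyI integrable_integral])
      show "0 \<le> g (p (Suc j)) - g (p j)" using osc[OF le] by linarith
    next
      fix u assume "u \<in> {p j..p (Suc j)} - {}"
      then have u: "u \<in> {p j..p (Suc j)}" by simp
      have "\<bar>f u - f (p (Suc j))\<bar> \<le> g (p (Suc j)) - g u" "\<bar>f (p j) - f u\<bar> \<le> g u - g (p j)"
        using u le by (auto intro!: osc)
      then show "norm (f u - f (p (Suc j))) \<le> g (p (Suc j)) - g (p j)" by auto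
    qed (use le in \<open>auto intro!: integrable_diff int\<close>)
    also have "integral {p j..p (Suc j)} (\<lambda>u. f u - f (p (Suc j)))
                 = integral {p j..p (Suc j)} f - h * f (p (Suc j))"
      using le h by (subst integral_diff) (auto intro!: int simp: p_Suc)
    finally have "\<bar>integral {p j..p (Suc j)} f - h * f (p (Suc j))\<bar> \<le> h * (g (p (Suc j)) - g (p j))"
      using h by (simp add: p_Suc mult.commute)
    with Suc show ?case unfolding split by (simp add: algebra_simps)
  qed
  from this[of m] show ?thesis
    using mh by (simp add: p_def h_def)
qed

text \<open>For \<open>u <= v\<close> this is \<open>1 - exp (u - v) <= v - u\<close> multiplied by
  \<open>exp v\<close>.\<close>

lemma exp_lipschitz:
  fixes a b c :: real
  assumes "a \<le> c" "b \<le> c"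
  shows "\<bar>exp a - exp b\<bar> \<le> exp c * \<bar>a - b\<bar>"
proof -
  have "exp v - exp u \<le> exp c * (v - u)" if "u \<le> v" "v \<le> c" for u v :: real
  proof -
    have "exp v - exp u = exp v * (1 - exp (u - v))" by (simp add: algebra_simps flip: exp_add)
    also have "\<dots> \<le> exp v * (v - u)"
      using exp_ge_add_one_self[of "u - v"] by (intro mult_left_mono) (linarith, simp)
    also have "\<dots> \<le> exp c * (v - u)" using that by (intro mult_right_mono) auto
    finally show ?thesis .
  qed
  from this[of a b] this[of b a] assms show ?thesis
    by (cases "a \<le> b") (auto simp: abs_if algebra_simps)
qed

text \<open>The hypothesis takes \<open>g\<close> at the right end of the step. For
  \<open>z < y\<close> it bounds the difference quotient directly; for \<open>y < z\<close> it
  involves \<open>g z\<close>, and continuity of \<open>g\<close> at \<open>y\<close> absorbs the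
  difference.\<close>

lemma has_vector_derivative_of_quadratic_error:
  fixes f g :: "real \<Rightarrow> real"
  assumes cont: "continuous_on {a..b} g"
    and err: "\<And>u v. a \<le> u \<Longrightarrow> u < v \<Longrightarrow> v \<le> b \<Longrightarrow> \<bar>f u - f v - (v - u) * g v\<bar> \<le> C * (v - u)\<^sup>2"
    and y: "y \<in> {a..b}"
  shows "(f has_vector_derivative - g y) (at y within {a..b})"
proof -
  have g: "(g \<longlongrightarrow> g y) (at y within {a..b})"
    using cont y by (auto simp: continuous_on_def)
  have 0: "((\<lambda>z. C * \<bar>z - y\<bar> + \<bar>g z - g y\<bar>) \<longlongrightarrow> C * \<bar>y - y\<bar> + \<bar>g y - g y\<bar>) (at y within {a..b})"
    by (intro tendsto_intros g)
  have "norm ((f z - f y) / (z - y) - (- g y)) \<le> C * \<bar>z - y\<bar> + \<bar>g z - g y\<bar>"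
    if z: "z \<in> {a..b}" "z \<noteq> y" for z
  proof -
    have eq: "norm ((f z - f y) / (z - y) - (- g y)) = \<bar>f z - f y + (z - y) * g y\<bar> / \<bar>z - y\<bar>"
      using z by (simp add: field_simps flip: abs_divide)
    have "\<bar>f z - f y + (z - y) * g y\<bar> \<le> C * (z - y)\<^sup>2 + \<bar>z - y\<bar> * \<bar>g z - g y\<bar>"
    proof (cases "z < y")
      case True
      have "f z - f y + (z - y) * g y = f z - f y - (y - z) * g y" by (simp add: algebra_simps)
      with err[of z y] True z y show ?thesis
        by (simp add: power2_commute) (smt (verit) mult_nonneg_nonneg)
    next
      case False
      have "f z - f y + (z - y) * g y = - (f y - f z - (z - y) * g z) - (z - y) * (g z - g y)"
        by (simp add: algebra_simps)
      then have "\<bar>f z - f y + (z - y) * g y\<bar>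
          \<le> \<bar>f y - f z - (z - y) * g z\<bar> + \<bar>(z - y) * (g z - g y)\<bar>" by linarith
      with err[of y z] False z y show ?thesis by (simp add: abs_mult)
    qed
    also have "\<dots> = \<bar>z - y\<bar> * (C * \<bar>z - y\<bar> + \<bar>g z - g y\<bar>)"
      by (simp add: algebra_simps power2_eq_square flip: power2_abs)
    finally show ?thesis unfolding eq using z by (simp add: divide_le_eq mult.commute)
  qed
  then have ev: "\<forall>\<^sub>F z in at y within {a..b}.
      norm ((f z - f y) / (z - y) - (- g y)) \<le> C * \<bar>z - y\<bar> + \<bar>g z - g y\<bar>"
    unfolding eventually_at_filter by (intro always_eventually) blast
  have "((\<lambda>z. (f z - f y) / (z - y)) \<longlongrightarrow> - g y) (at y within {a..b})"
    by (rule LIM_zero_cancel, rule Lim_null_comparison[OF ev]) (use 0 in simp)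
  then show ?thesis
    by (simp add: has_field_derivative_iff flip: has_real_derivative_iff_has_vector_derivative)
qed

text \<open>By the previous lemma \<open>f\<close> has derivative \<open>- g\<close> on the
  interval, so the fundamental theorem of calculus applies. The extended nonnegative form matches
  \<open>iterated_integral\<close>.\<close>

lemma nn_integral_of_quadratic_error:
  fixes f g :: "real \<Rightarrow> real"
  assumes cont: "continuous_on {a..b} g" and nonneg: "\<And>u. u \<in> {a..b} \<Longrightarrow> 0 \<le> g u"
    and err: "\<And>u v. a \<le> u \<Longrightarrow> u < v \<Longrightarrow> v \<le> b \<Longrightarrow> \<bar>f u - f v - (v - u) * g v\<bar> \<le> C * (v - u)\<^sup>2"
    and s: "a \<le> s" "s \<le> b"
  shows "(\<integral>\<^sup>+u\<in>{s..b}. ennreal (g u) \<partial>lborel) = ennreal (f s - f b)"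
proof -
  have "((\<lambda>u. - g u) has_integral f b - f s) {s..b}"
  proof (rule fundamental_theorem_of_calculus[OF s(2)])
    fix y assume y: "y \<in> {s..b}"
    show "(f has_vector_derivative - g y) (at y within {s..b})"
      by (rule has_vector_derivative_within_subset[where S = "{a..b}",
            OF has_vector_derivative_of_quadratic_error[OF cont err]]) (use s y in auto)
  qed
  then have "(g has_integral f s - f b) {s..b}"
    by (auto dest: has_integral_neg)
  then have I: "((\<lambda>u. indicator {s..b} u * g u) has_integral f s - f b) UNIV"
    by (subst (asm) has_integral_restrict_UNIV[symmetric])
       (simp add: indicator_def of_bool_def if_distrib[where f = "\<lambda>z. z * _"] cong: if_cong)
  have "(\<lambda>u. indicator {s..b} u * g u) \<in> borel_measurable borel"
    using borel_measurable_continuous_on_indicator[of "{s..b}" g] continuous_on_subset[OF cont, of "{s..b}"] s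
    by simp
  from nn_integral_has_integral_lborel[OF this _ I] have
    "(\<integral>\<^sup>+u. ennreal (indicator {s..b} u * g u) \<partial>lborel) = ennreal (f s - f b)"
    using nonneg s by (force simp: indicator_def)
  then show ?thesis
    by (simp add: mult.commute ennreal_mult'' ennreal_indicator)
qed

subsection \<open>Functionals of counting paths\<close>

text \<open>\<open>path_integral t r S \<nu>\<close> is the integral of \<open>S (\<nu> u - \<nu> r)\<close> over \<open>{r..t}\<close>. It is taken as a limit of
  Riemann sums, which makes it measurable in the path \<open>\<nu>\<close> and independent of the past when the
  increments of \<open>\<nu>\<close> are.\<close>

definition riemann_sum :: "real \<Rightarrow> real \<Rightarrow> (nat \<Rightarrow> real) \<Rightarrow> (real \<Rightarrow> nat) \<Rightarrow> nat \<Rightarrow> real" where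
  "riemann_sum t r S \<nu> m =
     (t - r) / real m * (\<Sum>k = 1..m. S (\<nu> (r + real k * ((t - r) / real m)) - \<nu> r))"

definition path_integral :: "real \<Rightarrow> real \<Rightarrow> (nat \<Rightarrow> real) \<Rightarrow> (real \<Rightarrow> nat) \<Rightarrow> real" where
  "path_integral t r S \<nu> = lim (riemann_sum t r S \<nu>)"

text \<open>The levels \<open>S\<close> may depend on the point as well as the path. Constant levels
  serve for the process alone, levels on a product space for the random jump sizes. Evaluating
  \<open>S\<close> at a random index stays measurable since the index is a natural number.\<close>

lemma measurable_path_integral:
  assumes \<nu>: "\<And>u. 0 \<le> u \<Longrightarrow> \<nu> u \<in> measurable L (count_space UNIV)"
    and S: "\<And>k. S k \<in> borel_measurable L" and r: "0 \<le> r" "r \<le> t"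
  shows "(\<lambda>p. path_integral t r (\<lambda>k. S k p) (\<lambda>u. \<nu> u p)) \<in> borel_measurable L"
    and "(\<lambda>p. riemann_sum t r (\<lambda>k. S k p) (\<lambda>u. \<nu> u p) m) \<in> borel_measurable L"
proof -
  have [measurable]: "\<nu> (r + real k * ((t - r) / real m)) \<in> measurable L (count_space UNIV)" for k m
    using r by (intro \<nu>) simp
  have [measurable]: "\<nu> r \<in> measurable L (count_space UNIV)" using r by (intro \<nu>)
  note [measurable] = S
  show R: "(\<lambda>p. riemann_sum t r (\<lambda>k. S k p) (\<lambda>u. \<nu> u p) m) \<in> borel_measurable L" for m
    unfolding riemann_sum_def
  proof (intro borel_measurable_times borel_measurable_sum borel_measurable_const)
    fix k
    have "(\<lambda>p. \<nu> (r + real k * ((t - r) / real m)) p - \<nu> r p) \<in> measurable L (count_space UNIV)"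
      by measurable
    then show "(\<lambda>p. S (\<nu> (r + real k * ((t - r) / real m)) p - \<nu> r p) p) \<in> borel_measurable L"
      by (rule measurable_compose_countable[OF S])
  qed
  show "(\<lambda>p. path_integral t r (\<lambda>k. S k p) (\<lambda>u. \<nu> u p)) \<in> borel_measurable L"
    \<comment> \<open>Where the Riemann sums diverge, \<open>lim\<close> takes one fixed default
      value, so measurability holds on the whole space.\<close>
    unfolding path_integral_def by (intro borel_measurable_lim_metric R)
qed

text \<open>A convenient majorant of the maximum: on a nondecreasing path with \<open>n\<close>
  jumps in the window it bounds every level visited.\<close>

definition level_bound :: "(nat \<Rightarrow> real) \<Rightarrow> nat \<Rightarrow> real" where
  "level_bound S n = (\<Sum>k\<le>n. \<bar>S k\<bar>)"

lemma level_bound_nonneg: "0 \<le> level_bound S n"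
  by (simp add: level_bound_def sum_nonneg)

lemma abs_le_level_bound: "k \<le> n \<Longrightarrow> \<bar>S k\<bar> \<le> level_bound S n"
  unfolding level_bound_def by (rule member_le_sum) auto

section \<open>Bounds and convergence along a single nondecreasing path\<close>

context
  fixes \<nu> :: "real \<Rightarrow> nat" and r t :: real and S :: "nat \<Rightarrow> real"
  assumes mono: "mono_on {0..} \<nu>" and r: "0 \<le> r" "r \<le> t"
begin

text \<open>Counts are integers: if the level changes at all, \<open>\<nu>\<close> has grown by at
  least 1, while the change is at most twice the level bound. A multiple of the path itself
  therefore controls the oscillation, as \<open>riemann_sum_error\<close> requires.\<close>

lemma path_oscillation:
  assumes "r \<le> u" "u \<le> v" "v \<le> t"
  shows "\<bar>S (\<nu> u - \<nu> r) - S (\<nu> v - \<nu> r)\<bar>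
    \<le> 2 * level_bound S (\<nu> t - \<nu> r) * real (\<nu> v) - 2 * level_bound S (\<nu> t - \<nu> r) * real (\<nu> u)"
proof -
  have le: "\<nu> u \<le> \<nu> v" "\<nu> v \<le> \<nu> t"
    using mono assms r by (auto intro!: mono_onD[OF mono])
  let ?K = "level_bound S (\<nu> t - \<nu> r)"
  show ?thesis
  proof (cases "\<nu> u = \<nu> v")
    case False
    with le have "1 \<le> real (\<nu> v) - real (\<nu> u)" by linarith
    then have "2 * ?K * 1 \<le> 2 * ?K * (real (\<nu> v) - real (\<nu> u))"
      using level_bound_nonneg by (intro mult_left_mono) auto
    then have "2 * ?K \<le> 2 * ?K * real (\<nu> v) - 2 * ?K * real (\<nu> u)"
      by (simp add: right_diff_distrib)
    moreover have "\<bar>S (\<nu> u - \<nu> r)\<bar> \<le> ?K" "\<bar>S (\<nu> v - \<nu> r)\<bar> \<le> ?K"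
      using le by (auto intro!: abs_le_level_bound)
    ultimately show ?thesis by linarith
  qed simp
qed

lemma path_integrable: "(\<lambda>u. S (\<nu> u - \<nu> r)) integrable_on {r..t}"
  and path_borel_measurable: "(\<lambda>u. S (\<nu> u - \<nu> r)) \<in> borel_measurable (restrict_space borel {r..t})"
  by (rule integrable_on_dominated_oscillation[OF path_oscillation]; assumption)+

lemma riemann_sum_LIMSEQ:
  "riemann_sum t r S \<nu> \<longlonglongrightarrow> integral {r..t} (\<lambda>u. S (\<nu> u - \<nu> r))"
proof -
  let ?I = "integral {r..t} (\<lambda>u. S (\<nu> u - \<nu> r))"
  define c where "c = (t - r) * (2 * level_bound S (\<nu> t - \<nu> r) * real (\<nu> t)
      - 2 * level_bound S (\<nu> t - \<nu> r) * real (\<nu> r))"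
  have "norm (riemann_sum t r S \<nu> m - ?I) \<le> c * (1 / real m)" if "m > 0" for m
    using riemann_sum_error[OF r(2) that path_oscillation]
    by (simp add: riemann_sum_def c_def)
  then have ev: "\<forall>\<^sub>F m in sequentially. norm (riemann_sum t r S \<nu> m - ?I) \<le> c * (1 / real m)"
    by (intro eventually_mono[OF eventually_gt_at_top[of 0]])
  have "(\<lambda>m. c * (1 / real m)) \<longlonglongrightarrow> 0"
    using tendsto_mult_left[OF lim_1_over_n, of c] by simp
  then show ?thesis
    by (rule LIM_zero_cancel[OF Lim_null_comparison[OF ev]])
qed

lemma path_integral_eq: "path_integral t r S \<nu> = integral {r..t} (\<lambda>u. S (\<nu> u - \<nu> r))"
  unfolding path_integral_def by (rule limI[OF riemann_sum_LIMSEQ])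

lemma abs_path_integral_le: "\<bar>path_integral t r S \<nu>\<bar> \<le> t * level_bound S (\<nu> t - \<nu> r)"
proof -
  have "norm (integral {r..t} (\<lambda>u. S (\<nu> u - \<nu> r))) \<le> level_bound S (\<nu> t - \<nu> r) * measure lborel {r..t}"
  proof (rule has_integral_bound_real[OF level_bound_nonneg finite.emptyI
        integrable_integral[OF path_integrable]])
    fix u assume "u \<in> {r..t} - {}"
    then have "\<nu> u \<le> \<nu> t" using mono r by (auto intro!: mono_onD[OF mono])
    then show "norm (S (\<nu> u - \<nu> r)) \<le> level_bound S (\<nu> t - \<nu> r)"
      by (auto intro!: abs_le_level_bound)
  qed
  also have "\<dots> \<le> t * level_bound S (\<nu> t - \<nu> r)"
    using r level_bound_nonneg[of S] by (simp add: mult.commute mult_mono)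
  finally show ?thesis by (simp add: path_integral_eq)
qed

text \<open>The bound is uniform in \<open>m\<close> and serves as the dominating constant when the
  mesh tends to zero. For \<open>m = 0\<close> the sum is zero by division by zero.\<close>

lemma abs_riemann_sum_le: "\<bar>riemann_sum t r S \<nu> m\<bar> \<le> t * level_bound S (\<nu> t - \<nu> r)"
proof (cases "m = 0")
  case False
  have "\<bar>S (\<nu> (r + real k * ((t - r) / real m)) - \<nu> r)\<bar> \<le> level_bound S (\<nu> t - \<nu> r)"
    if k: "k \<in> {1..m}" for k
  proof -
    have "real k * ((t - r) / real m) \<le> real m * ((t - r) / real m)"
      using k r by (intro mult_right_mono) auto
    then have "\<nu> (r + real k * ((t - r) / real m)) \<le> \<nu> t"
      using r False by (intro mono_onD[OF mono]) auto
    then show ?thesis by (auto intro!: abs_le_level_bound)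
  qed
  then have "\<bar>\<Sum>k = 1..m. S (\<nu> (r + real k * ((t - r) / real m)) - \<nu> r)\<bar>
      \<le> (\<Sum>k = 1..m. level_bound S (\<nu> t - \<nu> r))"
    by (intro order_trans[OF sum_abs] sum_mono)
  then have "\<bar>riemann_sum t r S \<nu> m\<bar> \<le> (t - r) / real m * (real m * level_bound S (\<nu> t - \<nu> r))"
    unfolding riemann_sum_def abs_mult using r by (intro mult_mono) auto
  also have "\<dots> \<le> t * level_bound S (\<nu> t - \<nu> r)"
    using False r level_bound_nonneg[of S] by (simp add: mult_right_mono)
  finally show ?thesis .
qed (use r level_bound_nonneg[of S] in \<open>simp add: riemann_sum_def\<close>)

end

text \<open>The integrand of \<open>F\<^sub>n(S, r)\<close>. Since the indicator fixes the number of
  jumps, only the levels up to \<open>n\<close> matter, and the weight is bounded on nondecreasing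
  paths even if \<open>S\<close> is unbounded.\<close>

definition path_weight :: "real \<Rightarrow> real \<Rightarrow> (nat \<Rightarrow> real) \<Rightarrow> nat \<Rightarrow> (real \<Rightarrow> nat) \<Rightarrow> real" where
  "path_weight t r S n \<nu> = of_bool (\<nu> t - \<nu> r = n) * exp (- path_integral t r S \<nu>)"

lemma abs_path_weight_le:
  assumes "mono_on {0..} \<nu>" "0 \<le> r" "r \<le> t"
  shows "\<bar>path_weight t r S n \<nu>\<bar> \<le> exp (t * level_bound S n)"
  using abs_path_integral_le[OF assms, of S] by (auto simp: path_weight_def)

text \<open>The first jump is either after \<open>r\<close>, or in \<open>{s<..r}\<close>, where it shifts the levels \<open>S\<close> by one.\<close>

lemma path_weight_increment:
  fixes \<nu> :: "real \<Rightarrow> nat" and S :: "nat \<Rightarrow> real" and n :: nat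
  assumes mono: "mono_on {0..} \<nu>" and s: "0 \<le> s" "s < r" "r \<le> t"
  defines "K \<equiv> level_bound S (Suc n)"
  shows "\<bar>path_weight t s S (Suc n) \<nu>
      - exp (- ((r - s) * S 0)) * (of_bool (\<nu> r - \<nu> s = 0) * path_weight t r S (Suc n) \<nu>
          + of_bool (\<nu> r - \<nu> s = 1) * path_weight t r (\<lambda>k. S (Suc k)) n \<nu>)\<bar>
      \<le> exp (t * K) * (2 * K * (r - s) * of_bool (\<nu> r - \<nu> s = 1) + of_bool (2 \<le> \<nu> r - \<nu> s))"
proof -
  have r: "0 \<le> r" "s \<le> t" using s by auto
  have le: "\<nu> s \<le> \<nu> r" "\<nu> r \<le> \<nu> t" using s by (auto intro!: mono_onD[OF mono])
  have K: "K \<ge> 0" unfolding K_def by (rule level_bound_nonneg)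
  let ?f = "\<lambda>u. S (\<nu> u - \<nu> s)"
  have int: "?f integrable_on {s..t}" by (rule path_integrable[OF mono s(1) r(2)])
  have int1: "?f integrable_on {s..r}"
    by (rule integrable_subinterval_real[OF int]) (use s in auto)
  have split: "path_integral t s S \<nu> = integral {s..r} ?f + integral {r..t} ?f"
    unfolding path_integral_eq[OF mono s(1) r(2)]
    using s by (intro Henstock_Kurzweil_Integration.integral_combine[symmetric] int) auto
  consider "\<nu> r = \<nu> s" | "\<nu> r = Suc (\<nu> s)" "\<nu> t - \<nu> s \<noteq> Suc n" | "\<nu> r = Suc (\<nu> s)" "\<nu> t - \<nu> s = Suc n"
    | "2 \<le> \<nu> r - \<nu> s" using le by linarith
  then show ?thesis
  proof cases
    \<comment> \<open>Without a jump in the step the recursion is exact: the level stays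
      \<open>S 0\<close> up to \<open>r\<close>.\<close>
    case 1
    have "\<nu> u = \<nu> s" if "u \<in> {s..r}" for u
      using 1 that s mono_onD[OF mono, of s u] mono_onD[OF mono, of u r] by auto
    then have "integral {s..r} ?f = integral {s..r} (\<lambda>_. S 0)"
      by (intro Henstock_Kurzweil_Integration.integral_cong) (metis diff_self_eq_0)
    then have "path_integral t s S \<nu> = (r - s) * S 0 + path_integral t r S \<nu>"
      unfolding split path_integral_eq[OF mono r(1) s(3)] using 1 s by simp
    then have "path_weight t s S (Suc n) \<nu> = exp (- ((r - s) * S 0)) * path_weight t r S (Suc n) \<nu>"
      using 1 by (simp add: path_weight_def exp_diff exp_minus divide_inverse)
    then show ?thesis using 1 by simp
  next
    \<comment> \<open>One jump but a wrong total: all weights vanish.\<close>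
    case 2
    then have "\<nu> t - \<nu> r \<noteq> n" using le by linarith
    then show ?thesis using 2 K s by (simp add: path_weight_def)
  next
    \<comment> \<open>The first-order case. After \<open>r\<close> the shifted levels describe the
      path exactly; the only error comes from replacing the level on \<open>{s..r}\<close> by
      \<open>S 0\<close>, which costs at most \<open>2 * K * (r - s)\<close> in the
      exponent.\<close>
    case 3
    then have n: "\<nu> t - Suc (\<nu> s) = n" by linarith
    let ?T = "\<lambda>k. S (Suc k)"
    have "integral {r..t} ?f = path_integral t r ?T \<nu>"
      unfolding path_integral_eq[OF mono r(1) s(3)]
    proof (rule Henstock_Kurzweil_Integration.integral_cong)
      fix u assume "u \<in> {r..t}"
      then have "\<nu> r \<le> \<nu> u" using r by (auto intro!: mono_onD[OF mono])
      then have "\<nu> u - \<nu> s = Suc (\<nu> u - \<nu> r)" using 3 by simp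
      then show "?f u = S (Suc (\<nu> u - \<nu> r))" by simp
    qed
    note split = split[unfolded this]
    have "norm (integral {s..r} (\<lambda>u. ?f u - S 0)) \<le> (2 * K) * measure lborel {s..r}"
    proof (rule has_integral_bound_real[OF _ finite.emptyI integrable_integral])
      fix u assume "u \<in> {s..r} - {}"
      then have "\<nu> u \<le> \<nu> t" using s by (auto intro!: mono_onD[OF mono])
      then have "\<bar>?f u\<bar> \<le> K" "\<bar>S 0\<bar> \<le> K"
        using 3 unfolding K_def by (intro abs_le_level_bound; simp)+
      then show "norm (?f u - S 0) \<le> 2 * K" by simp
    qed (use K int1 in \<open>auto intro!: integrable_diff\<close>)
    then have d: "\<bar>integral {s..r} ?f - (r - s) * S 0\<bar> \<le> 2 * K * (r - s)"
      using s by (subst (asm) integral_diff) (auto intro!: int1)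
    have "\<bar>path_integral t s S \<nu>\<bar> \<le> t * K"
      using abs_path_integral_le[OF mono s(1) r(2), of S] 3 by (simp add: K_def)
    \<comment> \<open>The two stretches contribute at most \<open>K * (r - s)\<close> and
      \<open>K * (t - r)\<close>, together at most \<open>t * K\<close>. Both exponents thus lie
      below the same bound, which gives the Lipschitz constant \<open>exp (t * K)\<close>.\<close>
    moreover have "- (path_integral t r ?T \<nu> + (r - s) * S 0) \<le> t * K"
    proof -
      have "\<bar>S 0\<bar> \<le> K" unfolding K_def by (rule abs_le_level_bound) simp
      then have "(r - s) * (- S 0) \<le> (r - s) * K" using s by (intro mult_left_mono) auto
      moreover have "norm (integral {r..t} (\<lambda>u. ?T (\<nu> u - \<nu> r))) \<le> K * measure lborel {r..t}"
      proof (rule has_integral_bound_real[OF K finite.emptyI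
            integrable_integral[OF path_integrable[OF mono r(1) s(3)]]])
        fix u assume "u \<in> {r..t} - {}"
        then have "\<nu> u \<le> \<nu> t" using r by (auto intro!: mono_onD[OF mono])
        then show "norm (?T (\<nu> u - \<nu> r)) \<le> K"
          using 3 unfolding K_def by (auto intro!: abs_le_level_bound)
      qed
      then have "\<bar>path_integral t r ?T \<nu>\<bar> \<le> K * (t - r)"
        unfolding path_integral_eq[OF mono r(1) s(3)] using s by simp
      moreover have "s * K \<ge> 0" using s K by simp
      ultimately show ?thesis by (simp add: algebra_simps abs_le_iff)
    qed
    ultimately have "\<bar>exp (- path_integral t s S \<nu>) - exp (- (path_integral t r ?T \<nu> + (r - s) * S 0))\<bar>
        \<le> exp (t * K) * \<bar>- path_integral t s S \<nu> - - (path_integral t r ?T \<nu> + (r - s) * S 0)\<bar>"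
      by (intro exp_lipschitz) auto
    also have "\<dots> \<le> exp (t * K) * (2 * K * (r - s))"
      using d by (intro mult_left_mono) (auto simp: split)
    also have "exp (- (path_integral t r ?T \<nu> + (r - s) * S 0))
        = exp (- ((r - s) * S 0)) * exp (- path_integral t r ?T \<nu>)"
      by (simp flip: exp_add)
    finally show ?thesis
      using 3 by (simp add: path_weight_def n)
  next
    \<comment> \<open>The bracket is zero here, so the crude bound on the weight suffices; smallness
      comes later from the probability of two jumps.\<close>
    case 4
    then have "\<not> \<nu> r \<le> \<nu> s" "\<nu> r - \<nu> s \<noteq> Suc 0" by auto
    then show ?thesis
      using 4 abs_path_weight_le[OF mono s(1) r(2), of S "Suc n"] by (simp add: K_def)
  qed
qed

subsection \<open>The backward equation\<close>

lemma measurable_add_nat: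
  fixes f g :: "'a \<Rightarrow> nat"
  assumes [measurable]: "f \<in> measurable L (count_space UNIV)" "g \<in> measurable L (count_space UNIV)"
  shows "(\<lambda>x. f x + g x) \<in> measurable L (count_space UNIV)"
  by measurable

section \<open>Poisson increments over short intervals\<close>

locale poisson_horizon = prob_space M for M :: "'a measure" +
  fixes \<theta> t :: real and N :: "real \<Rightarrow> 'a \<Rightarrow> nat"
  assumes poisson: "poisson_process \<theta> N" and horizon: "0 \<le> t"
begin

lemma rate_pos: "0 < \<theta>"
  using poisson by (simp add: poisson_process_def)

lemma count_measurable: "0 \<le> u \<Longrightarrow> N u \<in> measurable M (count_space UNIV)"
  using poisson by (simp add: poisson_process_def)

lemma AE_mono_paths: "AE \<omega> in M. mono_on {0..} (\<lambda>u. N u \<omega>)"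
proof -
  have "AE \<omega> in M. mono_on {0..} (\<lambda>u. N u \<omega>) \<and> (\<forall>u\<ge>0. continuous (at_right u) (\<lambda>u. N u \<omega>))"
    using poisson by (simp add: poisson_process_def)
  then show ?thesis by eventually_elim simp
qed

lemma increment_measurable:
  assumes "0 \<le> s" "0 \<le> r"
  shows "(\<lambda>\<omega>. N r \<omega> - N s \<omega>) \<in> measurable M (count_space UNIV)"
  using count_measurable[OF assms(1)] count_measurable[OF assms(2)] by measurable

lemma increment_of_bool_measurable:
  "0 \<le> s \<Longrightarrow> 0 \<le> r \<Longrightarrow> (\<lambda>\<omega>. of_bool (P (N r \<omega> - N s \<omega>)) :: real) \<in> borel_measurable M"
  by (rule measurable_compose[OF increment_measurable]) simp_all

lemma increment_of_bool_integrable: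
  "0 \<le> s \<Longrightarrow> 0 \<le> r \<Longrightarrow> integrable M (\<lambda>\<omega>. of_bool (P (N r \<omega> - N s \<omega>)) :: real)"
  by (rule integrable_const_bound[where B = 1]) (auto intro: increment_of_bool_measurable)

lemma expectation_increment_eq:
  assumes "0 \<le> s" "s < r"
  shows "expectation (\<lambda>\<omega>. of_bool (N r \<omega> - N s \<omega> = k))
    = (\<theta> * (r - s)) ^ k / fact k * exp (- (\<theta> * (r - s)))"
proof -
  let ?D = "\<lambda>\<omega>. N r \<omega> - N s \<omega>"
  have m: "?D \<in> measurable M (count_space UNIV)"
    using assms by (intro increment_measurable) auto
  have "expectation (\<lambda>\<omega>. of_bool (?D \<omega> = k)) = expectation (indicator (?D -` {k} \<inter> space M))"
    by (intro Bochner_Integration.integral_cong) (auto simp: indicator_def)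
  also have "\<dots> = measure (distr M (count_space UNIV) ?D) {k}"
    using m by (simp add: measure_distr)
  also have "distr M (count_space UNIV) ?D = measure_pmf (poisson_pmf (\<theta> * (r - s)))"
    using poisson assms by (simp add: poisson_process_def)
  also have "measure \<dots> {k} = (\<theta> * (r - s)) ^ k / fact k * exp (- (\<theta> * (r - s)))"
    using rate_pos assms by (simp add: measure_pmf_single)
  finally show ?thesis .
qed

text \<open>With \<open>y = \<theta> * (r - s)\<close>, the complement of no jump and one jump has
  probability \<open>1 - (1 + y) * exp (- y)\<close>, and \<open>exp (- y) >= 1 - y\<close> leaves
  at most the square of \<open>y\<close>.\<close>

lemma expectation_increment_ge_2:
  assumes "0 \<le> s" "s < r"
  shows "expectation (\<lambda>\<omega>. of_bool (2 \<le> N r \<omega> - N s \<omega>)) \<le> (\<theta> * (r - s))\<^sup>2"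
proof -
  let ?D = "\<lambda>\<omega>. N r \<omega> - N s \<omega>" and ?y = "\<theta> * (r - s)"
  have y: "0 \<le> ?y" using rate_pos assms by simp
  have s: "0 \<le> s" "0 \<le> r" using assms by auto
  have "expectation (\<lambda>\<omega>. of_bool (2 \<le> ?D \<omega>))
      = expectation (\<lambda>\<omega>. 1 - of_bool (?D \<omega> = 0) - of_bool (?D \<omega> = 1))"
    by (intro Bochner_Integration.integral_cong) auto
  also have "\<dots> = 1 - exp (- ?y) - ?y * exp (- ?y)"
    using expectation_increment_eq[OF assms, of 0] expectation_increment_eq[OF assms, of 1]
    by (simp add: increment_of_bool_integrable[OF s, of "\<lambda>k. k = 0", simplified]
        increment_of_bool_integrable[OF s, of "\<lambda>k. k = 1", simplified] prob_space)
  also have "\<dots> \<le> 1 - (1 + ?y) * (1 - ?y)"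
  proof -
    have "(1 + ?y) * (1 - ?y) \<le> (1 + ?y) * exp (- ?y)"
      using exp_ge_add_one_self[of "- ?y"] y by (intro mult_left_mono) (linarith, simp)
    then show ?thesis by (simp add: algebra_simps)
  qed
  also have "\<dots> = ?y\<^sup>2" by (simp add: algebra_simps power2_eq_square)
  finally show ?thesis .
qed

section \<open>Expected path weights\<close>

lemma path_weight_measurable:
  assumes "0 \<le> r" "r \<le> t"
  shows "(\<lambda>\<omega>. path_weight t r S n (\<lambda>u. N u \<omega>)) \<in> borel_measurable M"
proof -
  have [measurable]: "(\<lambda>\<omega>. path_integral t r S (\<lambda>u. N u \<omega>)) \<in> borel_measurable M"
    using assms by (intro measurable_path_integral(1)[where S = "\<lambda>k _. S k"] count_measurable) auto
  have [measurable]: "(\<lambda>\<omega>. of_bool (N t \<omega> - N r \<omega> = n) :: real) \<in> borel_measurable M"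
    using assms horizon by (intro increment_of_bool_measurable)
  show ?thesis unfolding path_weight_def by measurable
qed

lemma path_weight_integrable:
  assumes "0 \<le> r" "r \<le> t"
  shows "integrable M (\<lambda>\<omega>. path_weight t r S n (\<lambda>u. N u \<omega>))"
proof (rule integrable_const_bound[where B = "exp (t * level_bound S n)"])
  show "AE \<omega> in M. norm (path_weight t r S n (\<lambda>u. N u \<omega>)) \<le> exp (t * level_bound S n)"
    using AE_mono_paths
    by eventually_elim (simp add: abs_path_weight_le[OF _ assms])
qed (rule path_weight_measurable[OF assms])

text \<open>This is \<open>F\<^sub>n(S, r)\<close> for the fixed horizon \<open>t\<close>.\<close>

definition mean_weight :: "(nat \<Rightarrow> real) \<Rightarrow> nat \<Rightarrow> real \<Rightarrow> real" where
  "mean_weight S n r = expectation (\<lambda>\<omega>. path_weight t r S n (\<lambda>u. N u \<omega>))"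

lemma mean_weight_nonneg: "0 \<le> mean_weight S n r"
  unfolding mean_weight_def by (intro Bochner_Integration.integral_nonneg) (simp add: path_weight_def)

lemma path_weight_horizon: "path_weight t t S n \<nu> = of_bool (n = 0)"
proof -
  have "riemann_sum t t S \<nu> = (\<lambda>_. 0)" by (simp add: riemann_sum_def fun_eq_iff)
  then show ?thesis by (auto simp: path_weight_def path_integral_def)
qed

lemma mean_weight_horizon: "mean_weight S n t = of_bool (n = 0)"
  by (simp add: mean_weight_def path_weight_horizon prob_space)

text \<open>On the event of no jump the level is \<open>S 0\<close> throughout, so the weight is
  that event's indicator times a constant. The case \<open>s = t\<close> is separate because the
  Poisson law is given for increments over nonempty intervals.\<close>

lemma mean_weight_0:
  assumes "0 \<le> s" "s \<le> t"
  shows "mean_weight S 0 s = exp (- ((\<theta> + S 0) * (t - s)))"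
proof (cases "s = t")
  case False
  then have st: "s < t" using assms by simp
  have "AE \<omega> in M. path_weight t s S 0 (\<lambda>u. N u \<omega>)
      = of_bool (N t \<omega> - N s \<omega> = 0) * exp (- (S 0 * (t - s)))"
    using AE_mono_paths
  proof eventually_elim
    fix \<omega> assume mono: "mono_on {0..} (\<lambda>u. N u \<omega>)"
    show "path_weight t s S 0 (\<lambda>u. N u \<omega>)
        = of_bool (N t \<omega> - N s \<omega> = 0) * exp (- (S 0 * (t - s)))"
    proof (cases "N t \<omega> - N s \<omega> = 0")
      case True
      have "N u \<omega> - N s \<omega> = 0" if "u \<in> {s..t}" for u
        using True that assms mono_onD[OF mono, of u t] by auto
      then have "integral {s..t} (\<lambda>u. S (N u \<omega> - N s \<omega>)) = integral {s..t} (\<lambda>_. S 0)"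
        by (intro Henstock_Kurzweil_Integration.integral_cong) metis
      then show ?thesis
        using True assms by (simp add: path_weight_def path_integral_eq[OF mono assms] mult.commute)
    qed (simp add: path_weight_def)
  qed
  then have "mean_weight S 0 s
      = expectation (\<lambda>\<omega>. of_bool (N t \<omega> - N s \<omega> = 0) * exp (- (S 0 * (t - s))))"
    unfolding mean_weight_def using assms
    by (intro integral_cong_AE path_weight_measurable borel_measurable_times
        increment_of_bool_measurable) auto
  also have "\<dots> = exp (- (\<theta> * (t - s))) * exp (- (S 0 * (t - s)))"
    using expectation_increment_eq[OF assms(1) st, of 0] by simp
  finally show ?thesis by (simp add: algebra_simps flip: exp_add)
qed (simp add: mean_weight_horizon)

text \<open>A Riemann sum sees the path at finitely many times, so \<open>Z\<close> is almost surely
  a function of the increments over a grid of \<open>{r..t}\<close>. Finite-dimensional independence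
  of increments then separates it from the increment over \<open>{s..r}\<close>.\<close>

lemma expectation_increment_riemann:
  fixes S :: "nat \<Rightarrow> real" and n :: nat
  assumes s: "0 \<le> s" "s < r" "r < t" and m: "m > 0"
  defines "Z \<equiv> \<lambda>\<omega>. of_bool (N t \<omega> - N r \<omega> = n) * exp (- riemann_sum t r S (\<lambda>u. N u \<omega>) m)"
  shows "expectation (\<lambda>\<omega>. of_bool (N r \<omega> - N s \<omega> = j) * Z \<omega>)
    = expectation (\<lambda>\<omega>. of_bool (N r \<omega> - N s \<omega> = j)) * expectation Z"
    and "Z \<in> borel_measurable M"
proof -
  define h where "h = (t - r) / real m"
  have h: "h > 0" "real m * h = t - r" using s m by (auto simp: h_def)
  \<comment> \<open>The time \<open>s\<close> is put in front of the grid: \<open>D 0\<close> is the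
    increment over \<open>{s..r}\<close>, and \<open>D 1\<close> to \<open>D m\<close> belong to the
    cells of \<open>{r..t}\<close>.\<close>
  define \<tau> where "\<tau> i = (case i of 0 \<Rightarrow> s | Suc k \<Rightarrow> r + real k * h)" for i
  define D where "D i \<omega> = N (\<tau> (Suc i)) \<omega> - N (\<tau> i) \<omega>" for i \<omega>
  \<comment> \<open>Partial sums of the cell increments recover the counts since \<open>r\<close>,
    from which \<open>Y\<close> rebuilds \<open>Z\<close>.\<close>
  define Y where "Y f = of_bool ((\<Sum>i = 1..m. f i) = n) * exp (- (h * (\<Sum>k = 1..m. S (\<Sum>i = 1..k. f i))))"
    for f :: "nat \<Rightarrow> nat"
  have \<tau>: "0 \<le> \<tau> 0" "\<And>i. \<tau> i < \<tau> (Suc i)" "\<And>i. 0 \<le> \<tau> i"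
    using s h(1) by (auto simp: \<tau>_def algebra_simps split: nat.splits)
  have "indep_vars (\<lambda>_. count_space UNIV) D {..<Suc m}"
    unfolding D_def using poisson \<tau> by (simp add: poisson_process_def)
  then have "indep_var (PiM {0} (\<lambda>_. count_space UNIV)) (\<lambda>\<omega>. restrict (\<lambda>i. D i \<omega>) {0})
      (PiM {1..m} (\<lambda>_. count_space UNIV)) (\<lambda>\<omega>. restrict (\<lambda>i. D i \<omega>) {1..m})"
    by (rule indep_var_restrict) auto
  then have "indep_var borel ((\<lambda>f. of_bool (f 0 = j) :: real) \<circ> (\<lambda>\<omega>. restrict (\<lambda>i. D i \<omega>) {0}))
      borel (Y \<circ> (\<lambda>\<omega>. restrict (\<lambda>i. D i \<omega>) {1..m}))"
  proof (rule indep_var_compose)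
    have "(\<lambda>f. f 0) \<in> measurable (PiM {0} (\<lambda>_. count_space (UNIV :: nat set))) (count_space UNIV)"
      by (rule measurable_component_singleton) simp
    then show "(\<lambda>f. of_bool (f 0 = j) :: real) \<in> borel_measurable (PiM {0} (\<lambda>_. count_space UNIV))"
      by (rule measurable_compose) simp
    have sum: "(\<lambda>f. \<Sum>i = 1..k. f i) \<in> measurable (PiM {1..m} (\<lambda>_. count_space (UNIV :: nat set))) (count_space UNIV)"
      if "k \<le> m" for k
      using that
    proof (induction k)
      case (Suc k)
      then have 1: "(\<lambda>f. \<Sum>i = 1..k. f i) \<in> measurable (PiM {1..m} (\<lambda>_. count_space (UNIV :: nat set))) (count_space UNIV)"
        by simp
      have 2: "(\<lambda>f. f (Suc k)) \<in> measurable (PiM {1..m} (\<lambda>_. count_space (UNIV :: nat set))) (count_space UNIV)"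
        using Suc.prems by (intro measurable_component_singleton) simp
      have "(\<lambda>f. (\<Sum>i = 1..k. f i) + f (Suc k)) \<in> measurable (PiM {1..m} (\<lambda>_. count_space (UNIV :: nat set))) (count_space UNIV)"
        by (rule measurable_add_nat[OF 1 2])
      then show ?case by simp
    qed simp
    show "Y \<in> borel_measurable (PiM {1..m} (\<lambda>_. count_space UNIV))"
      unfolding Y_def
      by (intro borel_measurable_times borel_measurable_exp borel_measurable_uminus
          borel_measurable_const borel_measurable_sum
          measurable_compose[OF sum, of _ "\<lambda>k. of_bool (k = n)"] measurable_compose[OF sum, of _ S])
        auto
  qed
  moreover have "(\<lambda>f. of_bool (f 0 = j) :: real) \<circ> (\<lambda>\<omega>. restrict (\<lambda>i. D i \<omega>) {0})
      = (\<lambda>\<omega>. of_bool (N r \<omega> - N s \<omega> = j))"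
    by (auto simp: D_def \<tau>_def)
  ultimately have ind: "indep_var borel (\<lambda>\<omega>. of_bool (N r \<omega> - N s \<omega> = j) :: real)
      borel (Y \<circ> (\<lambda>\<omega>. restrict (\<lambda>i. D i \<omega>) {1..m}))" (is "indep_var _ ?U _ ?V")
    by simp
  have V: "?V \<in> borel_measurable M" using ind by (rule indep_var_rv2)
  have "AE \<omega> in M. mono_on {0..} (\<lambda>u. N u \<omega>)" by (rule AE_mono_paths)
  then have eq: "AE \<omega> in M. Z \<omega> = ?V \<omega>"
  proof eventually_elim
    fix \<omega> assume mono: "mono_on {0..} (\<lambda>u. N u \<omega>)"
    \<comment> \<open>With truncated subtraction the telescoping relies on monotonicity of the path,
      hence the equality only almost everywhere.\<close>
    have tele: "(\<Sum>i = 1..k. D i \<omega>) = N (r + real k * h) \<omega> - N r \<omega>" for k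
    proof (induction k)
      case (Suc k)
      have "N r \<omega> \<le> N (r + real k * h) \<omega>" "N (r + real k * h) \<omega> \<le> N (r + real (Suc k) * h) \<omega>"
        using s h(1) by (auto intro!: mono_onD[OF mono] simp: algebra_simps)
      then show ?case using Suc by (simp add: D_def \<tau>_def)
    qed simp
    have "(\<Sum>i = 1..k. restrict (\<lambda>i. D i \<omega>) {1..m} i) = N (r + real k * h) \<omega> - N r \<omega>" if "k \<le> m" for k
      unfolding tele[symmetric] using that by (intro sum.cong) auto
    then have "?V \<omega> = of_bool (N (r + real m * h) \<omega> - N r \<omega> = n)
        * exp (- (h * (\<Sum>k = 1..m. S (N (r + real k * h) \<omega> - N r \<omega>))))"
      by (simp add: Y_def cong: sum.cong_simp)
    then show "Z \<omega> = ?V \<omega>"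
      unfolding Z_def riemann_sum_def h_def[symmetric] using h(2) by simp
  qed
  have [measurable]: "(\<lambda>\<omega>. riemann_sum t r S (\<lambda>u. N u \<omega>) m) \<in> borel_measurable M"
    using s by (intro measurable_path_integral(2)[where S = "\<lambda>k _. S k"] count_measurable) auto
  have [measurable]: "(\<lambda>\<omega>. of_bool (N t \<omega> - N r \<omega> = n) :: real) \<in> borel_measurable M"
    using s by (intro increment_of_bool_measurable) auto
  show Z: "Z \<in> borel_measurable M" unfolding Z_def by measurable
  have "AE \<omega> in M. norm (Z \<omega>) \<le> exp (t * level_bound S n)"
    using AE_mono_paths
  proof eventually_elim
    fix \<omega> assume "mono_on {0..} (\<lambda>u. N u \<omega>)"
    from abs_riemann_sum_le[OF this, of r t S m] s
    show "norm (Z \<omega>) \<le> exp (t * level_bound S n)" by (auto simp: Z_def)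
  qed
  then have "integrable M Z" by (rule integrable_const_bound) (rule Z)
  then have V_int: "integrable M ?V"
    using eq Z V by (subst integrable_cong_AE[of _ _ Z]) auto
  have "expectation (\<lambda>\<omega>. ?U \<omega> * Z \<omega>) = expectation (\<lambda>\<omega>. ?U \<omega> * ?V \<omega>)"
    using eq s
    by (intro integral_cong_AE borel_measurable_times increment_of_bool_measurable Z V) auto
  also have "\<dots> = expectation ?U * expectation ?V"
    using s by (intro indep_var_lebesgue_integral ind V_int increment_of_bool_integrable) auto
  also have "expectation ?V = expectation Z"
    using eq Z V by (intro integral_cong_AE) auto
  finally show "expectation (\<lambda>\<omega>. ?U \<omega> * Z \<omega>) = expectation ?U * expectation Z" .
qed

text \<open>Dominated convergence carries the product rule from Riemann sums to the path integral.
  At \<open>r = t\<close> the weight is constant and the claim is immediate.\<close>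

lemma expectation_increment_weight:
  assumes s: "0 \<le> s" "s < r" "r \<le> t"
  shows "expectation (\<lambda>\<omega>. of_bool (N r \<omega> - N s \<omega> = j) * path_weight t r S n (\<lambda>u. N u \<omega>))
    = expectation (\<lambda>\<omega>. of_bool (N r \<omega> - N s \<omega> = j)) * mean_weight S n r"
proof (cases "r = t")
  case True
  then show ?thesis by (simp add: path_weight_horizon mean_weight_horizon)
next
  case False
  then have rt: "r < t" "0 \<le> r" using s by auto
  \<comment> \<open>\<open>Suc m\<close> keeps the grid nonempty.\<close>
  define Z where "Z m \<omega> = of_bool (N t \<omega> - N r \<omega> = n)
    * exp (- riemann_sum t r S (\<lambda>u. N u \<omega>) (Suc m))" for m \<omega>
  let ?U = "\<lambda>\<omega>. of_bool (N r \<omega> - N s \<omega> = j) :: real"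
  let ?W = "\<lambda>\<omega>. path_weight t r S n (\<lambda>u. N u \<omega>)"
  note fin = expectation_increment_riemann(1)[OF s(1,2) rt(1) zero_less_Suc,
      where S = S and n = n and j = j, folded Z_def]
    expectation_increment_riemann(2)[OF s(1,2) rt(1) zero_less_Suc,
      where S = S and n = n, folded Z_def]
  have U: "?U \<in> borel_measurable M" using s by (intro increment_of_bool_measurable) auto
  have W: "?W \<in> borel_measurable M" using s by (intro path_weight_measurable) auto
  have conv: "AE \<omega> in M. (\<lambda>m. Z m \<omega>) \<longlonglongrightarrow> ?W \<omega>"
    using AE_mono_paths
  proof eventually_elim
    fix \<omega> assume mono: "mono_on {0..} (\<lambda>u. N u \<omega>)"
    show "(\<lambda>m. Z m \<omega>) \<longlonglongrightarrow> ?W \<omega>"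
      unfolding Z_def path_weight_def path_integral_eq[OF mono rt(2) s(3)]
      by (intro tendsto_intros LIMSEQ_Suc riemann_sum_LIMSEQ mono rt s)
  qed
  have bound: "AE \<omega> in M. norm (Z m \<omega>) \<le> exp (t * level_bound S n)" for m
    using AE_mono_paths
  proof eventually_elim
    fix \<omega> assume "mono_on {0..} (\<lambda>u. N u \<omega>)"
    from abs_riemann_sum_le[OF this rt(2) s(3), of S "Suc m"]
    show "norm (Z m \<omega>) \<le> exp (t * level_bound S n)" by (auto simp: Z_def)
  qed
  have "(\<lambda>m. expectation (\<lambda>\<omega>. ?U \<omega> * Z m \<omega>)) \<longlonglongrightarrow> expectation (\<lambda>\<omega>. ?U \<omega> * ?W \<omega>)"
  proof (rule integral_dominated_convergence[where w = "\<lambda>_. exp (t * level_bound S n)"])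
    show "AE \<omega> in M. (\<lambda>m. ?U \<omega> * Z m \<omega>) \<longlonglongrightarrow> ?U \<omega> * ?W \<omega>"
      using conv by eventually_elim (intro tendsto_intros)
    show "AE \<omega> in M. norm (?U \<omega> * Z m \<omega>) \<le> exp (t * level_bound S n)" for m
      using bound[of m] by eventually_elim auto
  qed (use U W fin(2) in auto)
  moreover have "(\<lambda>m. expectation ?U * expectation (Z m)) \<longlonglongrightarrow> expectation ?U * expectation ?W"
    by (intro tendsto_mult_left integral_dominated_convergence[where w = "\<lambda>_. exp (t * level_bound S n)"]
        W fin(2) conv bound) simp
  ultimately show ?thesis
    unfolding fin(1) mean_weight_def by (rule LIMSEQ_unique)
qed

text \<open>Expectation of the pathwise estimate \<open>path_weight_increment\<close>. Its one-jump
  error has a factor \<open>r - s\<close> and probability at most \<open>\<theta> * (r - s)\<close>;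
  two or more jumps have probability of second order. Both errors are therefore quadratic.\<close>

lemma mean_weight_increment:
  fixes S :: "nat \<Rightarrow> real" and n :: nat
  assumes s: "0 \<le> s" "s < r" "r \<le> t"
  defines "K \<equiv> level_bound S (Suc n)"
  shows "\<bar>mean_weight S (Suc n) s
      - exp (- ((r - s) * S 0)) * (exp (- (\<theta> * (r - s))) * mean_weight S (Suc n) r
          + \<theta> * (r - s) * exp (- (\<theta> * (r - s))) * mean_weight (\<lambda>k. S (Suc k)) n r)\<bar>
      \<le> exp (t * K) * (2 * K * \<theta> + \<theta>\<^sup>2) * (r - s)\<^sup>2"
proof -
  have r: "0 \<le> r" "s \<le> t" using s by auto
  define U where "U j \<omega> = (of_bool (N r \<omega> - N s \<omega> = j) :: real)" for j \<omega>
  define V where "V \<omega> = (of_bool (2 \<le> N r \<omega> - N s \<omega>) :: real)" for \<omega>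
  let ?W = "\<lambda>s S n \<omega>. path_weight t s S n (\<lambda>u. N u \<omega>)"
  let ?T = "\<lambda>k. S (Suc k)"
  let ?c = "exp (- ((r - s) * S 0))"
  define Q where "Q \<omega> = ?W s S (Suc n) \<omega>
      - ?c * (U 0 \<omega> * ?W r S (Suc n) \<omega> + U 1 \<omega> * ?W r ?T n \<omega>)" for \<omega>
  define R where "R \<omega> = exp (t * K) * (2 * K * (r - s) * U 1 \<omega> + V \<omega>)" for \<omega>
  have K: "0 \<le> K" unfolding K_def by (rule level_bound_nonneg)
  have U_int: "integrable M (U j)" and V_int: "integrable M V" for j
    unfolding U_def V_def using s by (auto intro!: increment_of_bool_integrable)
  have W_int: "integrable M (?W s S (Suc n))" "integrable M (?W r S (Suc n))" "integrable M (?W r ?T n)"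
    using s r by (auto intro!: path_weight_integrable)
  have UW_int: "integrable M (\<lambda>\<omega>. U j \<omega> * f \<omega>)" if "integrable M f" for j f
    unfolding U_def by (rule Bochner_Integration.integrable_bound[OF that])
      (use s r that in \<open>auto intro!: borel_measurable_times increment_of_bool_measurable\<close>)
  have Q_int: "integrable M Q" and R_int: "integrable M R"
    unfolding Q_def R_def by (intro Bochner_Integration.integrable_diff Bochner_Integration.integrable_add
        integrable_mult_right UW_int W_int U_int V_int)+
  have "\<bar>expectation Q\<bar> \<le> expectation (\<lambda>\<omega>. \<bar>Q \<omega>\<bar>)"
    by (rule integral_abs_bound)
  also have "\<dots> \<le> expectation R"
  proof (rule integral_mono_AE)
    show "AE \<omega> in M. \<bar>Q \<omega>\<bar> \<le> R \<omega>"
      using AE_mono_paths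
    proof eventually_elim
      fix \<omega> assume "mono_on {0..} (\<lambda>u. N u \<omega>)"
      from path_weight_increment[OF this s, of S n] show "\<bar>Q \<omega>\<bar> \<le> R \<omega>"
        by (simp add: Q_def R_def K_def U_def V_def)
    qed
  qed (use Q_int R_int in auto)
  also have "expectation R = exp (t * K) * (2 * K * (r - s) * expectation (U 1) + expectation V)"
    unfolding R_def using U_int V_int by simp
  also have "\<dots> \<le> exp (t * K) * (2 * K * (r - s) * (\<theta> * (r - s)) + (\<theta> * (r - s))\<^sup>2)"
  proof (intro mult_left_mono add_mono)
    show "expectation (U 1) \<le> \<theta> * (r - s)"
      unfolding U_def expectation_increment_eq[OF s(1,2)] using rate_pos s by (simp add: mult_left_le)
    show "expectation V \<le> (\<theta> * (r - s))\<^sup>2" unfolding V_def by (rule expectation_increment_ge_2[OF s(1,2)])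
  qed (use K s in auto)
  also have "\<dots> = exp (t * K) * (2 * K * \<theta> + \<theta>\<^sup>2) * (r - s)\<^sup>2"
    by (simp add: algebra_simps power2_eq_square)
  also have "expectation Q = mean_weight S (Suc n) s
      - ?c * (expectation (\<lambda>\<omega>. U 0 \<omega> * ?W r S (Suc n) \<omega>) + expectation (\<lambda>\<omega>. U 1 \<omega> * ?W r ?T n \<omega>))"
    unfolding Q_def mean_weight_def using W_int UW_int by simp
  also have "\<dots> = mean_weight S (Suc n) s
      - ?c * (exp (- (\<theta> * (r - s))) * mean_weight S (Suc n) r
          + \<theta> * (r - s) * exp (- (\<theta> * (r - s))) * mean_weight ?T n r)"
    unfolding U_def expectation_increment_weight[OF s] expectation_increment_eq[OF s(1,2)] by simp
  finally show ?thesis .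
qed

text \<open>The prefactor turns the backward equation for \<open>mean_weight\<close> into one without a zeroth-order term.\<close>

definition normalized_weight :: "(nat \<Rightarrow> real) \<Rightarrow> nat \<Rightarrow> real \<Rightarrow> real" where
  "normalized_weight S n s = exp ((\<theta> + S 0) * (t - s)) * mean_weight S n s / \<theta> ^ n"

text \<open>The prefactor at \<open>u\<close> absorbs the decay over the step and becomes the
  prefactor at \<open>v\<close>. The shifted levels carry a prefactor with \<open>S 1\<close>
  instead of \<open>S 0\<close>, and the mismatch is the exponential in front of the shifted weight.
  \<open>C\<close> is uniform in the step.\<close>

lemma normalized_weight_increment:
  "\<exists>C. \<forall>u v. 0 \<le> u \<longrightarrow> u < v \<longrightarrow> v \<le> t \<longrightarrow>
    \<bar>normalized_weight S (Suc n) u - normalized_weight S (Suc n) v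
      - (v - u) * (exp (- ((S 1 - S 0) * (t - v))) * normalized_weight (\<lambda>k. S (Suc k)) n v)\<bar> \<le> C * (v - u)\<^sup>2"
proof (intro exI allI impI)
  fix u v assume uv: "0 \<le> u" "u < v" "v \<le> t"
  let ?T = "\<lambda>k. S (Suc k)"
  define E where "E w = exp ((\<theta> + S 0) * (t - w))" for w
  define K where "K = level_bound S (Suc n)"
  define B where "B = exp (t * K) * (2 * K * \<theta> + \<theta>\<^sup>2)"
  let ?X = "mean_weight S (Suc n) u
      - exp (- ((v - u) * S 0)) * (exp (- (\<theta> * (v - u))) * mean_weight S (Suc n) v
          + \<theta> * (v - u) * exp (- (\<theta> * (v - u))) * mean_weight ?T n v)"
  have EE: "E u * (exp (- ((v - u) * S 0)) * exp (- (\<theta> * (v - u)))) = E v"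
    unfolding E_def by (simp add: algebra_simps flip: exp_add)
  have "E u * ?X = E u * mean_weight S (Suc n) u
      - E u * (exp (- ((v - u) * S 0)) * exp (- (\<theta> * (v - u))))
          * (mean_weight S (Suc n) v + \<theta> * (v - u) * mean_weight ?T n v)"
    by (simp add: algebra_simps)
  also have "\<dots> = E u * mean_weight S (Suc n) u
      - E v * (mean_weight S (Suc n) v + \<theta> * (v - u) * mean_weight ?T n v)"
    unfolding EE ..
  finally have "E u * ?X / \<theta> ^ Suc n = (E u * mean_weight S (Suc n) u
      - E v * (mean_weight S (Suc n) v + \<theta> * (v - u) * mean_weight ?T n v)) / \<theta> ^ Suc n"
    by (rule arg_cong)
  also have "\<dots> = E u * mean_weight S (Suc n) u / \<theta> ^ Suc n
      - E v * mean_weight S (Suc n) v / \<theta> ^ Suc n - (v - u) * (E v * mean_weight ?T n v / \<theta> ^ n)"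
    using rate_pos by (simp add: field_simps)
  finally have EX: "E u * ?X / \<theta> ^ Suc n = E u * mean_weight S (Suc n) u / \<theta> ^ Suc n
      - E v * mean_weight S (Suc n) v / \<theta> ^ Suc n - (v - u) * (E v * mean_weight ?T n v / \<theta> ^ n)" .
  have "exp (- ((S 1 - S 0) * (t - v))) * exp ((\<theta> + S 1) * (t - v)) = E v"
    unfolding E_def by (simp add: algebra_simps flip: exp_add)
  then have g: "exp (- ((S 1 - S 0) * (t - v))) * normalized_weight ?T n v = E v * mean_weight ?T n v / \<theta> ^ n"
    by (simp add: normalized_weight_def flip: mult.assoc)
  have "normalized_weight S (Suc n) u - normalized_weight S (Suc n) v
      - (v - u) * (exp (- ((S 1 - S 0) * (t - v))) * normalized_weight ?T n v) = E u * ?X / \<theta> ^ Suc n"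
    unfolding EX g by (simp add: normalized_weight_def E_def)
  then have "\<bar>normalized_weight S (Suc n) u - normalized_weight S (Suc n) v
      - (v - u) * (exp (- ((S 1 - S 0) * (t - v))) * normalized_weight ?T n v)\<bar>
      = E u / \<theta> ^ Suc n * \<bar>?X\<bar>"
    using rate_pos by (simp add: abs_mult E_def)
  \<comment> \<open>The prefactor is bounded uniformly over the times in \<open>{0..t}\<close>,
    whatever the sign of \<open>\<theta> + S 0\<close>.\<close>
  also have "\<dots> \<le> exp (\<bar>\<theta> + S 0\<bar> * t) / \<theta> ^ Suc n * (B * (v - u)\<^sup>2)"
  proof (intro mult_mono divide_right_mono)
    have "(\<theta> + S 0) * (t - u) \<le> \<bar>\<theta> + S 0\<bar> * t" using uv by (intro mult_mono) auto
    then show "E u \<le> exp (\<bar>\<theta> + S 0\<bar> * t)" by (simp add: E_def)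
    show "\<bar>?X\<bar> \<le> B * (v - u)\<^sup>2"
      using mean_weight_increment[OF uv, of S n] by (simp add: B_def K_def)
  qed (use rate_pos in auto)
  finally show "\<bar>normalized_weight S (Suc n) u - normalized_weight S (Suc n) v
      - (v - u) * (exp (- ((S 1 - S 0) * (t - v))) * normalized_weight ?T n v)\<bar>
      \<le> exp (\<bar>\<theta> + S 0\<bar> * t) / \<theta> ^ Suc n * B * (v - u)\<^sup>2" by (simp add: mult.assoc)
qed

text \<open>Each integration removes the first jump and shifts the levels, so the induction keeps
  \<open>S\<close> arbitrary. Continuity is carried along because it is what lets the next integrand
  enter the fundamental theorem of calculus.\<close>

lemma normalized_weight_eq_iterated_integral:
  "continuous_on {0..t} (normalized_weight S n) \<and>
    (\<forall>s\<in>{0..t}. ennreal (normalized_weight S n s) =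
      iterated_integral t (map (\<lambda>i u. ennreal (exp (- ((S (Suc i) - S i) * (t - u))))) [0..<n]) s)"
proof (induction n arbitrary: S)
  case 0
  have "normalized_weight S 0 s = 1" if "s \<in> {0..t}" for s
    using that by (simp add: normalized_weight_def mean_weight_0 flip: exp_add)
  then show ?case by (simp cong: continuous_on_cong_simp)
next
  case (Suc n)
  let ?T = "\<lambda>k. S (Suc k)"
  let ?f = "normalized_weight S (Suc n)"
  let ?e = "\<lambda>u. exp (- ((S 1 - S 0) * (t - u)))"
  let ?g = "\<lambda>u. ?e u * normalized_weight ?T n u"
  obtain C where err: "\<And>u v. 0 \<le> u \<Longrightarrow> u < v \<Longrightarrow> v \<le> t \<Longrightarrow> \<bar>?f u - ?f v - (v - u) * ?g v\<bar> \<le> C * (v - u)\<^sup>2"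
    using normalized_weight_increment[of S n] by blast
  have cont: "continuous_on {0..t} ?g"
    using Suc.IH[of ?T] by (intro continuous_intros) auto
  have nonneg: "0 \<le> normalized_weight ?T n u" for u
    using mean_weight_nonneg rate_pos by (simp add: normalized_weight_def)
  have "continuous_on {0..t} ?f"
    unfolding continuous_on_eq_continuous_within
    by (intro ballI,
        rule has_vector_derivative_continuous[OF has_vector_derivative_of_quadratic_error[OF cont err]])
  moreover have "ennreal (?f s) = iterated_integral t
      (map (\<lambda>i u. ennreal (exp (- ((S (Suc i) - S i) * (t - u))))) [0..<Suc n]) s" if s: "s \<in> {0..t}" for s
  proof -
    let ?L = "map (\<lambda>i u. ennreal (exp (- ((?T (Suc i) - ?T i) * (t - u))))) [0..<n]"
    have "map (\<lambda>i u. ennreal (exp (- ((S (Suc i) - S i) * (t - u))))) [0..<Suc n] = (\<lambda>u. ennreal (?e u)) # ?L"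
      by (subst map_upt_Suc) (simp add: comp_def)
    then have "iterated_integral t
      (map (\<lambda>i u. ennreal (exp (- ((S (Suc i) - S i) * (t - u))))) [0..<Suc n]) s
        = (\<integral>\<^sup>+u\<in>{s..t}. (ennreal (?e u) * iterated_integral t ?L u) \<partial>lborel)" by simp
    also have "\<dots> = (\<integral>\<^sup>+u\<in>{s..t}. ennreal (?g u) \<partial>lborel)"
    proof (intro nn_integral_cong)
      fix u
      show "ennreal (?e u) * iterated_integral t ?L u * indicator {s..t} u = ennreal (?g u) * indicator {s..t} u"
        using Suc.IH[of ?T] s nonneg by (cases "u \<in> {s..t}") (auto simp: ennreal_mult)
    qed
    also have "\<dots> = ennreal (?f s - ?f t)"
      using s nonneg by (intro nn_integral_of_quadratic_error[OF cont _ err]) auto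
    also have "?f t = 0" by (simp add: normalized_weight_def mean_weight_horizon)
    finally show ?thesis by simp
  qed
  ultimately show ?case by simp
qed

end

subsection \<open>Averaging over the jump sizes\<close>

text \<open>Joint measurability in the starting time and the sample point, as Fubini requires; the
  starting time becomes the integration variable one level further out.\<close>

lemma measurable_iterated_integral:
  assumes [measurable]: "\<And>i. i \<in> set ks \<Longrightarrow> (\<lambda>(u, \<omega>). Y i u \<omega>) \<in> borel_measurable (borel \<Otimes>\<^sub>M L)"
  shows "(\<lambda>(s, \<omega>). iterated_integral t (map (\<lambda>i u. Y i u \<omega>) ks) s) \<in> borel_measurable (borel \<Otimes>\<^sub>M L)"
  using assms
proof (induction ks)
  case (Cons i ks)
  have [measurable]: "(\<lambda>(u, \<omega>). Y i u \<omega>) \<in> borel_measurable (borel \<Otimes>\<^sub>M L)"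
    using Cons.prems by simp
  have [measurable]: "(\<lambda>(s, \<omega>). iterated_integral t (map (\<lambda>i u. Y i u \<omega>) ks) s) \<in> borel_measurable (borel \<Otimes>\<^sub>M L)"
    using Cons by simp
  \<comment> \<open>The variable lower limit moves into the integrand, leaving a parameter integral
    over the fixed measure \<open>lborel\<close>.\<close>
  have eq: "(\<lambda>(s, \<omega>). iterated_integral t (map (\<lambda>i u. Y i u \<omega>) (i # ks)) s)
      = (\<lambda>p. \<integral>\<^sup>+u. (if fst p \<le> u \<and> u \<le> t then
          Y i u (snd p) * iterated_integral t (map (\<lambda>i u. Y i u (snd p)) ks) u else 0) \<partial>lborel)"
    by (auto simp: fun_eq_iff indicator_def intro!: nn_integral_cong)
  show ?case unfolding eq by measurable
qed simp

text \<open>The factors \<open>h j\<close> over \<open>J\<close> collect the integrands already pulled out of the outer integrals, so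
  that the induction needs only the product rule for independent variables.\<close>

lemma (in prob_space) expectation_iterated_integral:
  assumes indep: "indep_vars (\<lambda>_. borel) X A"
    and f: "\<And>i. i \<in> A \<Longrightarrow> case_prod (f i) \<in> borel_measurable (borel \<Otimes>\<^sub>M borel)"
    and ks: "distinct ks" "set ks \<subseteq> A"
    and J: "finite J" "J \<subseteq> A" "J \<inter> set ks = {}"
    and h: "\<And>j. j \<in> J \<Longrightarrow> h j \<in> borel_measurable borel"
  shows "(\<integral>\<^sup>+\<omega>. (\<Prod>j\<in>J. h j (X j \<omega>)) * iterated_integral t (map (\<lambda>i u. f i u (X i \<omega>)) ks) s \<partial>M)
    = (\<Prod>j\<in>J. \<integral>\<^sup>+\<omega>. h j (X j \<omega>) \<partial>M)
        * iterated_integral t (map (\<lambda>i u. \<integral>\<^sup>+\<omega>. (f i u (X i \<omega>) :: ennreal) \<partial>M) ks) s"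
  using ks J h
proof (induction ks arbitrary: J h s)
  case Nil
  have "indep_vars (\<lambda>_. borel) (\<lambda>j \<omega>. h j (X j \<omega>)) J"
    by (rule indep_vars_compose2[OF indep_vars_subset[OF indep]]) (use Nil in auto)
  then show ?case using Nil by (simp add: indep_vars_nn_integral)
next
  case (Cons i ks)
  have X: "X j \<in> borel_measurable M" if "j \<in> A" for j
    using indep that by (auto simp: indep_vars_def)
  have Y: "(\<lambda>(u, \<omega>). f j u (X j \<omega>)) \<in> borel_measurable (borel \<Otimes>\<^sub>M M)" if "j \<in> A" for j
  proof -
    note [measurable] = X[OF that] f[OF that]
    show ?thesis by measurable
  qed
  define R where "R = (\<lambda>u \<omega>. iterated_integral t (map (\<lambda>i u. f i u (X i \<omega>)) ks) u)"
  define P where "P \<omega> = (\<Prod>j\<in>J. h j (X j \<omega>))" for \<omega>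
  define c where "c = (\<Prod>j\<in>J. \<integral>\<^sup>+\<omega>. h j (X j \<omega>) \<partial>M)"
  define T where "T = iterated_integral t (map (\<lambda>i u. \<integral>\<^sup>+\<omega>. f i u (X i \<omega>) \<partial>M) ks)"
  define a where "a u = (\<integral>\<^sup>+\<omega>. f i u (X i \<omega>) \<partial>M)" for u
  have [measurable]: "(\<lambda>(u, \<omega>). R u \<omega>) \<in> borel_measurable (borel \<Otimes>\<^sub>M M)"
    unfolding R_def using Cons.prems by (intro measurable_iterated_integral Y) auto
  have [measurable]: "(\<lambda>(u, \<omega>). f i u (X i \<omega>)) \<in> borel_measurable (borel \<Otimes>\<^sub>M M)"
    using Cons.prems by (intro Y) simp
  have [measurable]: "P \<in> borel_measurable M"
    unfolding P_def using Cons.prems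
    by (intro borel_measurable_prod_ennreal measurable_compose[OF X]) auto
  have "(\<lambda>(u, \<omega>). \<integral>\<^sup>+\<omega>'. f j u (X j \<omega>') \<partial>M) \<in> borel_measurable (borel \<Otimes>\<^sub>M M)" if "j \<in> A" for j
  proof -
    note [measurable] = Y[OF that]
    show ?thesis by measurable
  qed
  \<comment> \<open>\<open>T\<close> is read as a function on the product that is constant in
    \<open>\<omega>\<close>, so that the joint result applies; a section at any sample point then
    gives measurability in time.\<close>
  then have T: "(\<lambda>(u, \<omega>). T u) \<in> borel_measurable (borel \<Otimes>\<^sub>M M)"
    unfolding T_def using Cons.prems
    by (intro measurable_iterated_integral[where Y = "\<lambda>i u \<omega>. \<integral>\<^sup>+\<omega>'. f i u (X i \<omega>') \<partial>M"]) auto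
  obtain \<omega>\<^sub>0 where "\<omega>\<^sub>0 \<in> space M" using not_empty by blast
  from measurable_Pair1[OF T this] have [measurable]: "T \<in> borel_measurable borel" by simp
  have [measurable]: "a \<in> borel_measurable borel" unfolding a_def by measurable
  have IH: "(\<integral>\<^sup>+\<omega>. P \<omega> * (f i u (X i \<omega>) * R u \<omega>) \<partial>M) = c * (a u * T u)" for u
  proof -
    \<comment> \<open>At a fixed time \<open>u\<close> the outer integrand becomes the factor of
      index \<open>i\<close>, and the induction hypothesis is used for
      \<open>insert i J\<close>.\<close>
    define h' where "h' = h(i := f i u)"
    have i: "i \<notin> J" "i \<in> A" using Cons.prems by auto
    have "(\<integral>\<^sup>+\<omega>. (\<Prod>j\<in>insert i J. h' j (X j \<omega>)) * R u \<omega> \<partial>M)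
      = (\<Prod>j\<in>insert i J. \<integral>\<^sup>+\<omega>. h' j (X j \<omega>) \<partial>M) * T u"
      unfolding R_def T_def
    proof (rule Cons.IH)
      fix j assume "j \<in> insert i J"
      moreover have "f i u \<in> borel_measurable borel"
        using measurable_Pair2[OF f[OF i(2)], of u] by simp
      ultimately show "h' j \<in> borel_measurable borel"
        using Cons.prems by (auto simp: h'_def)
    qed (use Cons.prems in auto)
    moreover have "(\<Prod>j\<in>insert i J. g j (h' j)) = g i (f i u) * (\<Prod>j\<in>J. g j (h j))"
      for g :: "_ \<Rightarrow> _ \<Rightarrow> ennreal"
      using Cons.prems i by (simp add: h'_def) (intro arg_cong2[where f = "(*)"] refl prod.cong; auto)
    note this[of "\<lambda>j q. q (X j _)"] this[of "\<lambda>j q. \<integral>\<^sup>+\<omega>. q (X j \<omega>) \<partial>M"]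
    ultimately show ?thesis
      by (simp add: P_def c_def a_def mult_ac)
  qed
  interpret pair_sigma_finite lborel M ..
  have "(\<integral>\<^sup>+\<omega>. P \<omega> * iterated_integral t (map (\<lambda>i u. f i u (X i \<omega>)) (i # ks)) s \<partial>M)
      = (\<integral>\<^sup>+\<omega>. (\<integral>\<^sup>+u. P \<omega> * (f i u (X i \<omega>) * R u \<omega>) * indicator {s..t} u \<partial>lborel) \<partial>M)"
    unfolding R_def[symmetric]
  proof (intro nn_integral_cong)
    fix \<omega> assume [measurable]: "\<omega> \<in> space M"
    have "P \<omega> * (\<integral>\<^sup>+u\<in>{s..t}. (f i u (X i \<omega>) * R u \<omega>) \<partial>lborel)
      = (\<integral>\<^sup>+u. P \<omega> * (f i u (X i \<omega>) * R u \<omega> * indicator {s..t} u) \<partial>lborel)"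
      by (rule nn_integral_cmult[symmetric]) measurable
    then show "P \<omega> * iterated_integral t (map (\<lambda>i u. f i u (X i \<omega>)) (i # ks)) s
      = (\<integral>\<^sup>+u. P \<omega> * (f i u (X i \<omega>) * R u \<omega>) * indicator {s..t} u \<partial>lborel)"
      by (simp add: R_def mult.assoc)
  qed
  also have "\<dots> = (\<integral>\<^sup>+u. (\<integral>\<^sup>+\<omega>. P \<omega> * (f i u (X i \<omega>) * R u \<omega>) * indicator {s..t} u \<partial>M) \<partial>lborel)"
    by (rule Fubini') measurable
  also have "\<dots> = (\<integral>\<^sup>+u. c * (a u * T u * indicator {s..t} u) \<partial>lborel)"
  proof (intro nn_integral_cong)
    fix u :: real
    show "(\<integral>\<^sup>+\<omega>. P \<omega> * (f i u (X i \<omega>) * R u \<omega>) * indicator {s..t} u \<partial>M) = c * (a u * T u * indicator {s..t} u)"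
      by (subst nn_integral_multc, measurable) (simp add: IH mult.assoc)
  qed
  also have "\<dots> = c * (\<integral>\<^sup>+u. a u * T u * indicator {s..t} u \<partial>lborel)"
    by (rule nn_integral_cmult) measurable
  finally show ?case by (simp add: P_def c_def a_def T_def)
qed

text \<open>Independence means that the diagonal map sends \<open>M\<close> to the product of its
  restrictions to the two \<sigma>-algebras. Tonelli's theorem then integrates the two arguments
  separately, which is what freezing the jump sizes amounts to.\<close>

lemma (in prob_space) nn_integral_indep_sigma_algebras:
  assumes indep: "indep_set (generated_events M S I Y) (generated_events M T J Z)"
    and Y: "\<And>i. i \<in> I \<Longrightarrow> Y i \<in> measurable M S" and Z: "\<And>j. j \<in> J \<Longrightarrow> Z j \<in> measurable M T"
    and g: "g \<in> borel_measurable (sigma (space M) (generated_events M S I Y) \<Otimes>\<^sub>M sigma (space M) (generated_events M T J Z))"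
  shows "(\<integral>\<^sup>+\<omega>. g (\<omega>, \<omega>) \<partial>M) = (\<integral>\<^sup>+\<omega>'. (\<integral>\<^sup>+\<omega>. g (\<omega>, \<omega>') \<partial>M) \<partial>M)"
proof -
  define P where "P = sigma (space M) (generated_events M S I Y)"
  define Q where "Q = sigma (space M) (generated_events M T J Z)"
  have gen: "(\<Union>i\<in>K. {W i -` A \<inter> space M | A. A \<in> sets U}) \<subseteq> Pow (space M)" for K W U by auto
  have gen_Pow: "generated_events M U K W \<subseteq> Pow (space M)" for U K W
    unfolding generated_events_def using sigma_sets_into_sp[OF gen] by blast
  have sets_eq: "sets (sigma (space M) (generated_events M U K W)) = generated_events M U K W" for U K W
    unfolding sets_measure_of[OF gen_Pow] by (simp only: generated_events_def sigma_sets_sigma_sets_eq[OF gen])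
  have meas: "id \<in> measurable M (sigma (space M) (generated_events M U K W))"
    if "\<And>i. i \<in> K \<Longrightarrow> W i \<in> measurable M U" for U K W
  proof (rule measurable_sigma_sets)
    show "sets (sigma (space M) (generated_events M U K W)) =
        sigma_sets (space M) (\<Union>i\<in>K. {W i -` A \<inter> space M | A. A \<in> sets U})"
      unfolding sets_eq by (simp add: generated_events_def)
  qed (use gen that in \<open>auto intro!: measurable_sets\<close>)
  \<comment> \<open>Events pulled back along the identity are unchanged, so independence of the two
    identity maps is exactly the assumed independence of the \<sigma>-algebras.\<close>
  have pre: "{id -` A \<inter> space M | A. A \<in> sets (sigma (space M) (generated_events M U K W))}
      = generated_events M U K W" for U K W
  proof -
    have "id -` A \<inter> space M = A" if "A \<in> generated_events M U K W" for A
      using subsetD[OF gen_Pow that] by auto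
    then show ?thesis unfolding sets_eq Setcompr_eq_image by (simp only: image_ident cong: image_cong)
  qed
  \<comment> \<open>On \<open>M\<close> the identity, read as a map into either sub-\<open>\<sigma>\<close>-algebra, is a random variable.\<close>
  have "indep_var P id Q id"
    unfolding indep_var_eq P_def Q_def pre
    using meas[OF Y] meas[OF Z] indep
    by (auto simp: generated_events_def sigma_sets_sigma_sets_eq[OF gen])
  then have id: "id \<in> measurable M P" "id \<in> measurable M Q"
    and eq: "distr M P id \<Otimes>\<^sub>M distr M Q id = distr M (P \<Otimes>\<^sub>M Q) (\<lambda>\<omega>. (id \<omega>, id \<omega>))"
    by (auto simp: indep_var_distribution_eq)
  interpret P: prob_space "distr M P id" by (rule prob_space_distr[OF id(1)])
  interpret Q: prob_space "distr M Q id" by (rule prob_space_distr[OF id(2)])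
  interpret PQ: pair_sigma_finite "distr M P id" "distr M Q id" ..
  have g': "g \<in> borel_measurable (P \<Otimes>\<^sub>M Q)" using g by (simp add: P_def Q_def)
  then have g'': "g \<in> borel_measurable (distr M P id \<Otimes>\<^sub>M distr M Q id)"
    by (simp cong: measurable_cong_sets)
  have "(\<integral>\<^sup>+\<omega>. g (\<omega>, \<omega>) \<partial>M) = integral\<^sup>N (distr M (P \<Otimes>\<^sub>M Q) (\<lambda>\<omega>. (id \<omega>, id \<omega>))) g"
    by (subst nn_integral_distr[OF measurable_Pair[OF id]]) (simp_all add: g')
  also have "\<dots> = (\<integral>\<^sup>+\<omega>'. (\<integral>\<^sup>+\<omega>. g (\<omega>, \<omega>') \<partial>distr M P id) \<partial>distr M Q id)"
    unfolding eq[symmetric] by (rule PQ.nn_integral_snd[symmetric, OF g''])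
  also have "\<dots> = (\<integral>\<^sup>+\<omega>'. (\<integral>\<^sup>+\<omega>. g (\<omega>, \<omega>') \<partial>distr M P id) \<partial>M)"
    using P.borel_measurable_nn_integral[OF measurable_pair_swap[OF g'']]
    by (subst nn_integral_distr[OF id(2)]) simp_all
  also have "\<dots> = (\<integral>\<^sup>+\<omega>'. (\<integral>\<^sup>+\<omega>. g (\<omega>, \<omega>') \<partial>M) \<partial>M)"
  proof (intro nn_integral_cong)
    fix \<omega>' assume "\<omega>' \<in> space M"
    then have "(\<lambda>\<omega>. g (\<omega>, \<omega>')) \<in> borel_measurable P"
      using g' by (intro measurable_Pair1[OF g']) (simp add: Q_def gen_Pow)
    then show "(\<integral>\<^sup>+\<omega>. g (\<omega>, \<omega>') \<partial>distr M P id) = (\<integral>\<^sup>+\<omega>. g (\<omega>, \<omega>') \<partial>M)"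
      using id by (subst nn_integral_distr) auto
  qed
  finally show ?thesis .
qed

text \<open>Links the Lebesgue integral defining the process with the gauge integral behind
  \<open>path_integral\<close>. They agree because the integrand is measurable and bounded on a
  compact interval.\<close>

lemma set_lebesgue_integral_path:
  assumes mono: "mono_on {0..} \<nu>" and r: "0 \<le> r" "r \<le> t"
  shows "(LINT u:{r..t}|lborel. S (\<nu> u - \<nu> r)) = path_integral t r S \<nu>"
proof -
  have "integrable lborel (\<lambda>u. indicator {r..t} u *\<^sub>R S (\<nu> u - \<nu> r))"
  proof (rule integrableI_bounded_set[where A = "{r..t}" and B = "level_bound S (\<nu> t - \<nu> r)"])
    show "(\<lambda>u. indicator {r..t} u *\<^sub>R S (\<nu> u - \<nu> r)) \<in> borel_measurable lborel"
      using path_borel_measurable[OF assms, of S]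
      by (subst (asm) borel_measurable_restrict_space_iff) auto
    show "AE u in lborel. u \<in> {r..t} \<longrightarrow> norm (indicator {r..t} u *\<^sub>R S (\<nu> u - \<nu> r)) \<le> level_bound S (\<nu> t - \<nu> r)"
    proof (intro AE_I2 impI)
      fix u assume u: "u \<in> {r..t}"
      then have "\<nu> u \<le> \<nu> t" using r by (auto intro!: mono_onD[OF mono])
      then show "norm (indicator {r..t} u *\<^sub>R S (\<nu> u - \<nu> r)) \<le> level_bound S (\<nu> t - \<nu> r)"
        using u by (auto intro!: abs_le_level_bound)
    qed
  qed (auto simp: emeasure_lborel_Icc_eq)
  then show ?thesis
    unfolding path_integral_eq[OF assms]
    by (intro set_borel_integral_eq_integral) (simp add: set_integrable_def)
qed

text \<open>The expectation is split by the number of jumps. As \<open>S 0 = 0\<close>, undoing the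
  normalization at time 0 leaves just \<open>exp (- (\<theta> * t))\<close> and the power of
  \<open>\<theta>\<close>.\<close>

lemma (in poisson_horizon) nn_integral_exp_path_integral:
  assumes "S 0 = 0"
  shows "(\<integral>\<^sup>+\<omega>. ennreal (exp (- path_integral t 0 S (\<lambda>u. N u \<omega>))) \<partial>M)
    = (\<Sum>n. ennreal (exp (- (\<theta> * t))) * (ennreal (\<theta> ^ n) *
        iterated_integral t (map (\<lambda>i u. ennreal (exp (- ((S (Suc i) - S i) * (t - u))))) [0..<n]) 0))"
proof -
  let ?W = "\<lambda>n \<omega>. path_weight t 0 S n (\<lambda>u. N u \<omega>)"
  have "ennreal (exp (- path_integral t 0 S (\<lambda>u. N u \<omega>))) = (\<Sum>n. ennreal (?W n \<omega>))" for \<omega>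
    \<comment> \<open>For each path only the term of its actual jump count is nonzero.\<close>
    by (subst suminf_finite[where N = "{N t \<omega> - N 0 \<omega>}"]) (auto simp: path_weight_def)
  then have "(\<integral>\<^sup>+\<omega>. ennreal (exp (- path_integral t 0 S (\<lambda>u. N u \<omega>))) \<partial>M)
      = (\<integral>\<^sup>+\<omega>. (\<Sum>n. ennreal (?W n \<omega>)) \<partial>M)" by simp
  also have "\<dots> = (\<Sum>n. \<integral>\<^sup>+\<omega>. ennreal (?W n \<omega>) \<partial>M)"
    using path_weight_measurable[OF order_refl horizon] by (intro nn_integral_suminf) simp
  also have "\<dots> = (\<Sum>n. ennreal (exp (- (\<theta> * t))) * (ennreal (\<theta> ^ n) *
        iterated_integral t (map (\<lambda>i u. ennreal (exp (- ((S (Suc i) - S i) * (t - u))))) [0..<n]) 0))"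
  proof (rule suminf_cong)
    fix n
    have "(\<integral>\<^sup>+\<omega>. ennreal (?W n \<omega>) \<partial>M) = ennreal (mean_weight S n 0)"
      unfolding mean_weight_def
      by (intro nn_integral_eq_integral path_weight_integrable order_refl horizon)
        (simp add: path_weight_def)
    also have "mean_weight S n 0 = exp (- (\<theta> * t)) * (\<theta> ^ n * normalized_weight S n 0)"
      using rate_pos assms by (simp add: normalized_weight_def exp_minus)
    also have "ennreal \<dots> = ennreal (exp (- (\<theta> * t))) * (ennreal (\<theta> ^ n) * ennreal (normalized_weight S n 0))"
      using rate_pos by (simp add: ennreal_mult' ennreal_mult'')
    also have "ennreal (normalized_weight S n 0)
        = iterated_integral t (map (\<lambda>i u. ennreal (exp (- ((S (Suc i) - S i) * (t - u))))) [0..<n]) 0"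
      using normalized_weight_eq_iterated_integral[of S n] horizon by auto
    finally show "(\<integral>\<^sup>+\<omega>. ennreal (?W n \<omega>) \<partial>M) = ennreal (exp (- (\<theta> * t))) * (ennreal (\<theta> ^ n) *
        iterated_integral t (map (\<lambda>i u. ennreal (exp (- ((S (Suc i) - S i) * (t - u))))) [0..<n]) 0)" .
  qed
  finally show ?thesis .
qed

lemma generated_events_measurable:
  assumes "i \<in> I" "\<And>i. i \<in> I \<Longrightarrow> Y i \<in> measurable M S"
  shows "Y i \<in> measurable (sigma (space M) (generated_events M S I Y)) S"
proof (rule measurableI)
  have gen: "(\<Union>i\<in>I. {Y i -` A \<inter> space M | A. A \<in> sets S}) \<subseteq> Pow (space M)" by auto
  have Pow: "generated_events M S I Y \<subseteq> Pow (space M)"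
    unfolding generated_events_def using sigma_sets_into_sp[OF gen] by blast
  fix A assume "A \<in> sets S"
  then have "Y i -` A \<inter> space M \<in> generated_events M S I Y"
    unfolding generated_events_def using assms(1) by (intro sigma_sets.Basic) auto
  then show "Y i -` A \<inter> space (sigma (space M) (generated_events M S I Y))
      \<in> sets (sigma (space M) (generated_events M S I Y))"
    using Pow by (auto simp: space_measure_of_conv)
qed (use assms in \<open>auto simp: space_measure_of_conv dest: measurable_space\<close>)

theorem proposition4:
  fixes M :: "'a measure" and N :: "real \<Rightarrow> 'a \<Rightarrow> nat" and X :: "nat \<Rightarrow> 'a \<Rightarrow> real"
    and \<theta> t x :: real
  assumes "prob_space M"
    and "prob_space.poisson_process M \<theta> N"
    and "prob_space.indep_vars M (\<lambda>_. borel) X {1..}"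
    and "prob_space.indep_set M (generated_events M (count_space UNIV) {0..} N)
                                (generated_events M borel {1..} X)"
    and "t \<ge> 0"
  shows "laplace_transform M (integrated_process N X t) x =
           ennreal (exp (- (\<theta> * t))) *
           (1 + (\<Sum>m. let n = Suc m in ennreal (\<theta> ^ n) *
                   iterated_integral t
                     (map (\<lambda>i u. laplace_transform M (X i) (x * (t - u))) [1..<Suc n]) 0))"
proof -
  interpret prob_space M by fact
  interpret poisson_horizon M \<theta> t N
    by unfold_locales (use assms in auto)
  have X: "X i \<in> borel_measurable M" if "1 \<le> i" for i
    using assms(3) that by (auto simp: indep_vars_def)
  define S where "S k \<omega> = x * (\<Sum>i = 1..k. X i \<omega>)" for k \<omega>
  define f where "f i u y = ennreal (exp (- (x * (t - u) * y)))" for i :: nat and u y :: real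
  \<comment> \<open>The path is taken at \<open>\<omega>\<close> and the jump sizes at
    \<open>\<omega>'\<close>; the diagonal gives back the original variable.\<close>
  define g where "g = (\<lambda>(\<omega>, \<omega>'). ennreal (exp (- path_integral t 0 (\<lambda>k. S k \<omega>') (\<lambda>u. N u \<omega>))))"
  let ?I = "\<lambda>n \<omega>. iterated_integral t (map (\<lambda>i u. f i u (X i \<omega>)) [1..<Suc n]) 0"
  let ?L = "\<lambda>n. iterated_integral t (map (\<lambda>i u. laplace_transform M (X i) (x * (t - u))) [1..<Suc n]) 0"
  have f: "case_prod (f i) \<in> borel_measurable (borel \<Otimes>\<^sub>M borel)" for i
    unfolding f_def by measurable
  have "AE \<omega> in M. N 0 \<omega> = 0"
    using assms(2) by (simp add: poisson_process_def)
  with AE_mono_paths have "AE \<omega> in M. ennreal (exp (- (x * integrated_process N X t \<omega>))) = g (\<omega>, \<omega>)"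
  proof eventually_elim
    fix \<omega> assume mono: "mono_on {0..} (\<lambda>u. N u \<omega>)" and 0: "N 0 \<omega> = 0"
    \<comment> \<open>\<open>path_integral\<close> counts jumps after time 0, so it matches the
      process because \<open>N 0\<close> vanishes almost surely.\<close>
    have "x * integrated_process N X t \<omega> = (LINT u:{0..t}|lborel. S (N u \<omega> - N 0 \<omega>) \<omega>)"
      unfolding integrated_process_def compound_process_def S_def by (simp add: 0)
    also have "\<dots> = path_integral t 0 (\<lambda>k. S k \<omega>) (\<lambda>u. N u \<omega>)"
      by (rule set_lebesgue_integral_path[OF mono order_refl horizon])
    finally show "ennreal (exp (- (x * integrated_process N X t \<omega>))) = g (\<omega>, \<omega>)"
      by (simp add: g_def)
  qed
  then have "laplace_transform M (integrated_process N X t) x = (\<integral>\<^sup>+\<omega>. g (\<omega>, \<omega>) \<partial>M)"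
    unfolding laplace_transform_def by (rule nn_integral_cong_AE)
  also have "\<dots> = (\<integral>\<^sup>+\<omega>'. (\<integral>\<^sup>+\<omega>. g (\<omega>, \<omega>') \<partial>M) \<partial>M)"
  proof (rule nn_integral_indep_sigma_algebras[OF assms(4)])
    let ?P = "sigma (space M) (generated_events M (count_space UNIV) {0..} N)"
    let ?Q = "sigma (space M) (generated_events M borel {1..} X)"
    have N': "N u \<in> measurable ?P (count_space UNIV)" if "0 \<le> u" for u
      by (rule generated_events_measurable) (use that count_measurable in auto)
    have X': "X i \<in> measurable ?Q borel" if "1 \<le> i" for i
      by (rule generated_events_measurable) (use that X in auto)
    have "(\<lambda>p. S k (snd p)) \<in> borel_measurable (?P \<Otimes>\<^sub>M ?Q)" for k
      unfolding S_def
      by (intro borel_measurable_times borel_measurable_const borel_measurable_sum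
          measurable_compose[OF measurable_snd X']) auto
    then have "(\<lambda>p. path_integral t 0 (\<lambda>k. S k (snd p)) (\<lambda>u. N u (fst p))) \<in> borel_measurable (?P \<Otimes>\<^sub>M ?Q)"
      by (intro measurable_path_integral(1)[where \<nu> = "\<lambda>u p. N u (fst p)"]
          measurable_compose[OF measurable_fst N'] horizon order_refl)
    note [measurable] = this
    show "g \<in> borel_measurable (?P \<Otimes>\<^sub>M ?Q)"
      unfolding g_def case_prod_beta by measurable
  qed (use count_measurable X in auto)
  also have "\<dots> = (\<integral>\<^sup>+\<omega>'. (\<Sum>n. ennreal (exp (- (\<theta> * t))) * (ennreal (\<theta> ^ n) * ?I n \<omega>')) \<partial>M)"
  proof (intro nn_integral_cong)
    fix \<omega>'
    \<comment> \<open>Consecutive levels differ by \<open>x * X (Suc i)\<close>: the level index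
      \<open>i\<close> starting at 0 corresponds to jump \<open>Suc i\<close>.\<close>
    have "map (\<lambda>i u. ennreal (exp (- ((S (Suc i) \<omega>' - S i \<omega>') * (t - u))))) [0..<n]
        = map (\<lambda>i u. f i u (X i \<omega>')) [1..<Suc n]" for n
      unfolding One_nat_def map_Suc_upt[symmetric] by (simp add: S_def f_def algebra_simps)
    then show "(\<integral>\<^sup>+\<omega>. g (\<omega>, \<omega>') \<partial>M) = (\<Sum>n. ennreal (exp (- (\<theta> * t))) * (ennreal (\<theta> ^ n) * ?I n \<omega>'))"
      using nn_integral_exp_path_integral[of "\<lambda>k. S k \<omega>'"] by (simp add: g_def S_def)
  qed
  also have "\<dots> = (\<Sum>n. ennreal (exp (- (\<theta> * t))) * (ennreal (\<theta> ^ n) * ?L n))"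
  proof -
    have "(\<lambda>(s, \<omega>). iterated_integral t (map (\<lambda>i u. f i u (X i \<omega>)) [1..<Suc n]) s)
        \<in> borel_measurable (borel \<Otimes>\<^sub>M M)" for n
    proof (rule measurable_iterated_integral)
      fix i assume "i \<in> set [1..<Suc n]"
      then have [measurable]: "X i \<in> borel_measurable M" by (intro X) auto
      show "(\<lambda>(u, \<omega>). f i u (X i \<omega>)) \<in> borel_measurable (borel \<Otimes>\<^sub>M M)"
        using f[of i] by measurable
    qed
    from measurable_Pair2[OF this, of 0] have [measurable]: "?I n \<in> borel_measurable M" for n
      by simp
    have I: "(\<integral>\<^sup>+\<omega>. ?I n \<omega> \<partial>M) = ?L n" for n
      \<comment> \<open>Initially no factor has been pulled out, hence the empty
        \<open>J\<close>.\<close>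
      using expectation_iterated_integral[OF assms(3), where f = f and ks = "[1..<Suc n]" and J = "{}" and t = t and s = 0] f
      by (simp add: laplace_transform_def f_def subset_eq del: upt_Suc)
    show ?thesis
      by (subst nn_integral_suminf, measurable, subst nn_integral_cmult, measurable,
          subst nn_integral_cmult, measurable) (simp only: I)
  qed
  also have "\<dots> = ennreal (exp (- (\<theta> * t))) * (\<Sum>n. ennreal (\<theta> ^ n) * ?L n)"
    by (rule ennreal_suminf_cmult)
  \<comment> \<open>The term \<open>n = 0\<close> has an empty iterated integral and yields the
    leading 1.\<close>
  also have "(\<Sum>n. ennreal (\<theta> ^ n) * ?L n) = 1 + (\<Sum>m. ennreal (\<theta> ^ Suc m) * ?L (Suc m))"
    by (subst suminf_offset[where i = 1]) (simp_all add: add.commute del: upt_Suc power_Suc)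
  finally show ?thesis by (simp add: Let_def del: upt_Suc power_Suc)
qed

end
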